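(* Let $k\geq 2$ and $\mathcal{U}=\{C_2,C_4,\ldots,C_{2k}\}$, and let $\mathcal{D}_{\mathcal{U}}\subseteq\mathbb{R}^k$ be the density profile of $\mathcal{U}$. Let $$Q_{\mathcal{U}}=\{(y_2,y_4,\ldots,y_{2k})\in\mathbb{R}^k:\ y_{2i}-2y_{2i+2}+y_{2i+4}\geq 0\ (1\leq i\leq k-2),\ \ 2ky_{2k-2}-(2k-2)y_{2k}\geq 0,\ \ -2ky_2+y_{2k}\geq 0\}.$$ Then $\operatorname{trop}(\mathcal{D}_{\mathcal{U}})=Q_{\mathcal{U}}$.
   Context: All graphs are finite and simple. $C_m$ denotes the cycle on $m$ vertices, and $C_2=K_2$ is the single edge. $t(H,T)=\operatorname{hom}(H,T)/v(T)^{v(H)}$ is the homomorphism density. For a finite list of graphs $\mathcal{U}=\{H_1,\ldots,H_s\}$, the density profile $\mathcal{D}_{\mathcal{U}}$ is the closure in $\mathbb{R}^s$ of the set of vectors $(t(H_1,T),\ldots,t(H_s,T))$ over all graphs $T$. For a base $b$, $\log_b(\mathcal{D}_{\mathcal{U}})$ is the image of $\mathcal{D}_{\mathcal{U}}\cap\mathbb{R}^s_{>0}$ under the coordinatewise map $\mathbf{v}\mapsto(\log_b v_1,\ldots,\log_b v_s)$, and the tropicalization is $\operatorname{trop}(\mathcal{D}_{\mathcal{U}})=\lim_{t\to 0}\log_{1/t}(\mathcal{D}_{\mathcal{U}})$. *)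

theory Defs
  imports "HOL-Analysis.Analysis" "Graph_Theory.Pair_Digraph"
begin

text \<open>
  Finite simple graphs are the elements of \<^locale>\<open>pair_graph\<close>: finite, loop-free digraphs
  with a symmetric arc relation, so that every undirected edge is a pair of opposite arcs.
\<close>

definition hom_set :: "'a pair_pre_digraph \<Rightarrow> 'b pair_pre_digraph \<Rightarrow> ('a \<Rightarrow> 'b) set" where
  "hom_set H T = {f \<in> pverts H \<rightarrow>\<^sub>E pverts T. \<forall>(u, v) \<in> parcs H. (f u, f v) \<in> parcs T}"

definition hom_density :: "'a pair_pre_digraph \<Rightarrow> 'b pair_pre_digraph \<Rightarrow> real" where
  "hom_density H T = real (card (hom_set H T)) / real (card (pverts T)) ^ card (pverts H)"

text \<open>
  For \<open>m \<ge> 3\<close> this is the cycle on \<open>m\<close> vertices; for \<open>m = 2\<close> the two arc conditions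
  coincide and it is the single edge \<open>K\<^sub>2\<close>. It is not loop-free for \<open>m = 1\<close>.
\<close>

definition cycle_graph :: "nat \<Rightarrow> nat pair_pre_digraph" where
  "cycle_graph m =
     \<lparr> pverts = {..<m},
       parcs = {(u, v). u < m \<and> v < m \<and> (v = (u + 1) mod m \<or> u = (v + 1) mod m)} \<rparr>"

lemma pair_graph_cycle_graph:
  assumes "m \<ge> 2"
  shows "pair_graph (cycle_graph m)"
proof -
  have neq: "(u + 1) mod m \<noteq> u" if "u < m" for u
    using that assms by (cases "u + 1 = m") auto
  have "finite (parcs (cycle_graph m))"
    by (rule finite_subset[of _ "{..<m} \<times> {..<m}"]) (auto simp: cycle_graph_def)
  then show ?thesis
    using neq
    by unfold_locales (auto simp: cycle_graph_def symmetric_def arcs_ends_conv intro!: symI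
        dest: neq[symmetric])
qed

lemma cycle_graph_2: "parcs (cycle_graph 2) = {(0, 1), (1, 0)}"
  by (auto simp: cycle_graph_def less_2_cases_iff)

definition even_cycles :: "nat \<Rightarrow> nat pair_pre_digraph list" where
  "even_cycles k = map (\<lambda>i. cycle_graph (2 * i)) [1..<k + 1]"

text \<open>
  \<open>\<real>\<^sup>s\<close> is \<^term>\<open>Euclidean_space s\<close>, whose points are the \<open>x :: nat \<Rightarrow> real\<close> with \<open>x i = 0\<close>
  for \<open>i \<ge> s\<close>; the coordinates are thus numbered \<open>0, \<dots>, s - 1\<close>.
\<close>

definition density_vector :: "'a pair_pre_digraph list \<Rightarrow> 'b pair_pre_digraph \<Rightarrow> nat \<Rightarrow> real" where
  "density_vector Hs T = (\<lambda>i. if i < length Hs then hom_density (Hs ! i) T else 0)"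

text \<open>
  Every finite graph is isomorphic to one with vertices in \<^typ>\<open>nat\<close>. The target graph has to
  have a vertex for the density to be defined.
\<close>

definition density_profile :: "'a pair_pre_digraph list \<Rightarrow> (nat \<Rightarrow> real) set" where
  "density_profile Hs =
     Euclidean_space (length Hs) closure_of
       {density_vector Hs T | T :: nat pair_pre_digraph. pair_graph T \<and> pverts T \<noteq> {}}"

definition log_image :: "nat \<Rightarrow> real \<Rightarrow> (nat \<Rightarrow> real) set \<Rightarrow> (nat \<Rightarrow> real) set" where
  "log_image s b D = (\<lambda>v i. if i < s then log b (v i) else 0) ` {v \<in> D. \<forall>i<s. v i > 0}"

text \<open>
  Limits of families of sets are taken in the sense of Painlev\'e and Kuratowski: the lower and
  the upper limit have to agree.
\<close>

definition lower_limit :: "'a topology \<Rightarrow> ('b \<Rightarrow> 'a set) \<Rightarrow> 'b filter \<Rightarrow> 'a set" where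
  "lower_limit X A F =
     {x \<in> topspace X. \<forall>U. openin X U \<and> x \<in> U \<longrightarrow> (\<forall>\<^sub>F t in F. A t \<inter> U \<noteq> {})}"

definition upper_limit :: "'a topology \<Rightarrow> ('b \<Rightarrow> 'a set) \<Rightarrow> 'b filter \<Rightarrow> 'a set" where
  "upper_limit X A F =
     {x \<in> topspace X. \<forall>U. openin X U \<and> x \<in> U \<longrightarrow> (\<exists>\<^sub>F t in F. A t \<inter> U \<noteq> {})}"

definition set_limit :: "'a topology \<Rightarrow> ('b \<Rightarrow> 'a set) \<Rightarrow> 'a set \<Rightarrow> 'b filter \<Rightarrow> bool" where
  "set_limit X A L F \<longleftrightarrow> lower_limit X A F = L \<and> upper_limit X A F = L"

lemma set_limit_unique: "set_limit X A L F \<Longrightarrow> set_limit X A L' F \<Longrightarrow> L = L'"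
  by (simp add: set_limit_def)

definition is_trop :: "nat \<Rightarrow> (nat \<Rightarrow> real) set \<Rightarrow> (nat \<Rightarrow> real) set \<Rightarrow> bool" where
  "is_trop s D L \<longleftrightarrow> set_limit (Euclidean_space s) (\<lambda>t. log_image s (1 / t) D) L (at_right 0)"

text \<open>Meaningful only if the limit exists, i.e. if \<open>is_trop s D L\<close> holds for some \<open>L\<close>.\<close>

definition trop :: "nat \<Rightarrow> (nat \<Rightarrow> real) set \<Rightarrow> (nat \<Rightarrow> real) set" where
  "trop s D = (THE L. is_trop s D L)"

text \<open>
  The coordinate \<open>y\<^sub>2\<^sub>j\<close>, belonging to the cycle on \<open>2j\<close> vertices, is \<open>y (j - 1)\<close>.
\<close>

definition Q_cone :: "nat \<Rightarrow> (nat \<Rightarrow> real) set" where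
  "Q_cone k =
     {y \<in> topspace (Euclidean_space k).
        (\<forall>i. 1 \<le> i \<and> i \<le> k - 2 \<longrightarrow> y (i - 1) - 2 * y i + y (i + 1) \<ge> 0) \<and>
        2 * real k * y (k - 2) - (2 * real k - 2) * y (k - 1) \<ge> 0 \<and>
        - 2 * real k * y 0 + y (k - 1) \<ge> 0}"

end

theory Submission
  imports Defs "HOL-Number_Theory.Cong" "HOL-Real_Asymp.Real_Asymp"
begin

text \<open>
  The number of homomorphisms from the \<open>2 i\<close>-cycle is the squared Frobenius norm of the \<open>i\<close>-th
  power of the adjacency matrix, so the three kinds of inequalities follow from the Cauchy--Schwarz
  inequality alone: log-convexity, monotonicity of the Schatten norms and Sidorenko's inequality.
  They survive the closure and put every logarithmic image inside the cone.

  Conversely, tensor products multiply densities, so the tropicalization contains the closed convex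
  cone spanned by the logarithmic density vectors of single graphs. The cone of the theorem is
  simplicial. One of its rays is approximated by an edge with many isolated vertices. The others come
  from the graph on the nonzero residues modulo a prime \<open>P\<close> in which \<open>u\<close> and \<open>v\<close> are adjacent if
  \<open>u * v mod P \<le> x\<close>, where \<open>x\<close> is about the \<open>j\<close>-th root of \<open>P\<close>: closed walks of length \<open>2 i\<close> with
  \<open>i \<le> j\<close> correspond to solutions of \<open>a\<^sub>1 \<cdots> a\<^sub>i = b\<^sub>1 \<cdots> b\<^sub>i\<close> in \<open>{1..x}\<close>, and by
  the divisor bound there are only \<open>x\<close> to the \<open>i + o(1)\<close> of them.
\<close>

section \<open>Walks and the inequalities between cycle counts\<close>

lemma pair_graph_iff:
  "pair_graph T \<longleftrightarrow> finite (pverts T) \<and> parcs T \<subseteq> pverts T \<times> pverts T \<and>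
     sym (parcs T) \<and> irrefl (parcs T)" (is "?L \<longleftrightarrow> ?R")
proof
  assume ?L
  then interpret pair_graph T .
  show ?R
    using pair_finite_verts in_arcsD1 in_arcsD2 pair_sym_arcs pair_no_loops
    by (fastforce simp: symmetric_def irrefl_def)
next
  assume R: ?R
  then have "finite (parcs T)"
    by (metis finite_SigmaI finite_subset)
  with R show ?L
    by unfold_locales (auto simp: symmetric_def irrefl_def)
qed

text \<open>Entries of the powers of the adjacency matrix A, real-valued so that Cauchy--Schwarz for
  sums applies to them directly.\<close>

primrec walks :: "'a pair_pre_digraph \<Rightarrow> nat \<Rightarrow> 'a \<Rightarrow> 'a \<Rightarrow> real" where
  "walks T 0 u v = of_bool (u = v)"
| "walks T (Suc l) u v = (\<Sum>x\<in>pverts T. walks T l u x * of_bool ((x, v) \<in> parcs T))"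

text \<open>For a graph this is the sum of the 2i-th powers of the eigenvalues of A. Index 0, which
  counts the vertices, takes part in the convexity below.\<close>

definition walk_moment :: "'a pair_pre_digraph \<Rightarrow> nat \<Rightarrow> real" where
  "walk_moment T i = (\<Sum>u\<in>pverts T. \<Sum>v\<in>pverts T. (walks T i u v)\<^sup>2)"

lemma walks_add:
  assumes "finite (pverts T)" "v \<in> pverts T"
  shows "walks T (a + b) u v = (\<Sum>x\<in>pverts T. walks T a u x * walks T b x v)"
  using assms(2)
proof (induction b arbitrary: v)
  case 0
  then show ?case using assms(1) by (simp add: if_distrib of_bool_def cong: if_cong)
next
  case (Suc b)
  have "walks T (a + Suc b) u v =
      (\<Sum>y\<in>pverts T. \<Sum>x\<in>pverts T. walks T a u x * walks T b x y * of_bool ((y, v) \<in> parcs T))"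
    by (simp add: Suc.IH sum_distrib_right)
  also have "\<dots> =
      (\<Sum>x\<in>pverts T. \<Sum>y\<in>pverts T. walks T a u x * walks T b x y * of_bool ((y, v) \<in> parcs T))"
    by (rule sum.swap)
  also have "\<dots> = (\<Sum>x\<in>pverts T. walks T a u x * walks T (Suc b) x v)"
    by (simp add: sum_distrib_left mult.assoc)
  finally show ?case .
qed

lemma walks_1:
  assumes "finite (pverts T)" "u \<in> pverts T"
  shows "walks T 1 u v = of_bool ((u, v) \<in> parcs T)"
proof -
  have "walks T 1 u v = (\<Sum>x\<in>pverts T. if x = u then of_bool ((x, v) \<in> parcs T) else 0)"
    by (auto intro!: sum.cong)
  then show ?thesis using assms by simp
qed

lemma walks_sym:
  assumes "pair_graph T" "u \<in> pverts T" "v \<in> pverts T"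
  shows "walks T l u v = walks T l v u"
  using assms(2,3)
proof (induction l arbitrary: u v)
  case 0
  then show ?case by auto
next
  case (Suc l)
  have fin: "finite (pverts T)" and sm: "sym (parcs T)"
    using assms(1) by (auto simp: pair_graph_iff)
  have "walks T (Suc l) u v = (\<Sum>x\<in>pverts T. walks T 1 v x * walks T l x u)"
    using Suc fin sm by (auto simp: walks_1[unfolded One_nat_def] mult.commute simp del: walks.simps(2)
        intro!: sum.cong simp: walks.simps(2)[of T l] dest: symD)
  also have "\<dots> = walks T (1 + l) v u"
    using Suc.prems fin by (rule_tac walks_add[symmetric]) auto
  finally show ?case by simp
qed

lemma walk_moment_eq_trace:
  assumes "pair_graph T"
  shows "walk_moment T i = (\<Sum>u\<in>pverts T. walks T (2 * i) u u)"
proof -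
  have "walks T (2 * i) u u = (\<Sum>v\<in>pverts T. (walks T i u v)\<^sup>2)" if "u \<in> pverts T" for u
  proof -
    have "walks T (i + i) u u = (\<Sum>v\<in>pverts T. walks T i u v * walks T i v u)"
      using that assms by (intro walks_add) (auto simp: pair_graph_iff)
    also have "\<dots> = (\<Sum>v\<in>pverts T. (walks T i u v)\<^sup>2)"
      using walks_sym[OF assms] that by (intro sum.cong) (auto simp: power2_eq_square)
    finally show ?thesis by (simp add: mult_2)
  qed
  then show ?thesis by (simp add: walk_moment_def)
qed

lemma walk_moment_0:
  assumes "finite (pverts T)"
  shows "walk_moment T 0 = real (card (pverts T))"
proof -
  have "(\<Sum>v\<in>pverts T. (walks T 0 u v)\<^sup>2) = (\<Sum>v\<in>pverts T. if v = u then 1 else 0)" for u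
    by (rule sum.cong) auto
  then show ?thesis using assms by (simp add: walk_moment_def del: walks.simps)
qed

lemma walk_moment_nonneg: "walk_moment T i \<ge> 0"
  by (auto simp: walk_moment_def intro!: sum_nonneg)

lemma walk_moment_1:
  assumes "finite (pverts T)"
  shows "walk_moment T 1 = (\<Sum>u\<in>pverts T. \<Sum>v\<in>pverts T. walks T 1 u v)"
  unfolding walk_moment_def using walks_1[OF assms] by (intro sum.cong) auto

lemma walk_moment_1_eq_card:
  assumes "pair_graph T"
  shows "walk_moment T 1 = real (card (parcs T))"
proof -
  have fin: "finite (pverts T)" and sub: "parcs T \<subseteq> pverts T \<times> pverts T"
    using assms by (auto simp: pair_graph_iff)
  have "walk_moment T 1 = (\<Sum>u\<in>pverts T. \<Sum>v\<in>pverts T. of_bool ((u, v) \<in> parcs T))"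
    unfolding walk_moment_1[OF fin] using walks_1[OF fin] by (intro sum.cong) auto
  also have "\<dots> = (\<Sum>e\<in>pverts T \<times> pverts T. of_bool (e \<in> parcs T))"
    by (simp add: sum.cartesian_product case_prod_beta)
  also have "\<dots> = (\<Sum>e\<in>parcs T. 1)"
    using fin sub by (intro sum.mono_neutral_cong_right) auto
  finally show ?thesis by simp
qed

text \<open>The trace of A^(2i+2), split unevenly as \<open>i + (i + 2)\<close>, is the Frobenius
  inner product of A^i and A^(i+2), to which Cauchy--Schwarz applies.\<close>

lemma walk_moment_log_convex:
  assumes "pair_graph T"
  shows "(walk_moment T (i + 1))\<^sup>2 \<le> walk_moment T i * walk_moment T (i + 2)"
proof -
  let ?V = "pverts T"
  have fin: "finite ?V" using assms by (simp add: pair_graph_iff)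
  have "walk_moment T (i + 1) = (\<Sum>u\<in>?V. walks T (i + (i + 2)) u u)"
    by (simp add: walk_moment_eq_trace[OF assms] mult_2 del: walks.simps)
  also have "\<dots> = (\<Sum>u\<in>?V. \<Sum>v\<in>?V. walks T i u v * walks T (i + 2) v u)"
    by (intro sum.cong refl walks_add fin)
  also have "\<dots> = (\<Sum>u\<in>?V. \<Sum>v\<in>?V. walks T i u v * walks T (i + 2) u v)"
  proof (intro sum.cong refl)
    fix u v assume "u \<in> ?V" "v \<in> ?V"
    then show "walks T i u v * walks T (i + 2) v u = walks T i u v * walks T (i + 2) u v"
      by (metis walks_sym[OF assms])
  qed
  also have "\<dots> = (\<Sum>(u,v)\<in>?V \<times> ?V. walks T i u v * walks T (i + 2) u v)"
    by (rule sum.cartesian_product)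
  finally have "(walk_moment T (i + 1))\<^sup>2 =
      (\<Sum>e\<in>?V \<times> ?V. walks T i (fst e) (snd e) * walks T (i + 2) (fst e) (snd e))\<^sup>2"
    by (simp add: case_prod_beta)
  also have "\<dots> \<le> (\<Sum>e\<in>?V \<times> ?V. (walks T i (fst e) (snd e))\<^sup>2) *
      (\<Sum>e\<in>?V \<times> ?V. (walks T (i + 2) (fst e) (snd e))\<^sup>2)"
    by (rule Cauchy_Schwarz_ineq_sum)
  also have "\<dots> = walk_moment T i * walk_moment T (i + 2)"
    by (simp add: walk_moment_def sum.cartesian_product case_prod_beta del: walks.simps)
  finally show ?thesis .
qed

text \<open>Submultiplicativity of the Frobenius norm for A^i times A^i: Cauchy--Schwarz bounds each
  entry by the norms of a row and a column.\<close>

lemma walk_moment_double_le: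
  assumes "pair_graph T"
  shows "walk_moment T (2 * i) \<le> (walk_moment T i)\<^sup>2"
proof -
  let ?V = "pverts T"
  have fin: "finite ?V" using assms by (simp add: pair_graph_iff)
  have "walk_moment T (2 * i) = (\<Sum>u\<in>?V. \<Sum>v\<in>?V. (\<Sum>x\<in>?V. walks T i u x * walks T i x v)\<^sup>2)"
    unfolding walk_moment_def using walks_add[OF fin, of _ i i] by (intro sum.cong) (auto simp: mult_2)
  also have "\<dots> \<le> (\<Sum>u\<in>?V. \<Sum>v\<in>?V. (\<Sum>x\<in>?V. (walks T i u x)\<^sup>2) * (\<Sum>x\<in>?V. (walks T i x v)\<^sup>2))"
    by (intro sum_mono Cauchy_Schwarz_ineq_sum)
  also have "\<dots> = walk_moment T i * (\<Sum>v\<in>?V. \<Sum>x\<in>?V. (walks T i x v)\<^sup>2)"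
    by (simp add: walk_moment_def sum_product)
  also have "(\<Sum>v\<in>?V. \<Sum>x\<in>?V. (walks T i x v)\<^sup>2) = walk_moment T i"
    unfolding walk_moment_def by (rule sum.swap)
  finally show ?thesis by (simp add: power2_eq_square)
qed

text \<open>Blakley--Roy for walks whose length is a power of two, by iterated Cauchy--Schwarz.\<close>

lemma walk_total_ge:
  assumes "pair_graph T" "pverts T \<noteq> {}"
  shows "(\<Sum>u\<in>pverts T. \<Sum>v\<in>pverts T. walks T (2 ^ q) u v)
    \<ge> real (card (pverts T)) * (walk_moment T 1 / real (card (pverts T))) ^ (2 ^ q)"
proof (induction q)
  let ?V = "pverts T"
  have fin: "finite ?V" using assms by (simp add: pair_graph_iff)
  then have n0: "real (card ?V) > 0" using assms(2) by (simp add: card_gt_0_iff)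
  {
    case 0
    show ?case using n0 walk_moment_1[OF fin] by simp
  next
    case (Suc q)
    let ?m = "2 ^ q :: nat"
    let ?n = "real (card ?V)"
    let ?r = "\<lambda>x. \<Sum>v\<in>?V. walks T ?m x v"
    have ge0: "walk_moment T 1 / ?n \<ge> 0" by (simp add: walk_moment_nonneg)
    have "(?n * (walk_moment T 1 / ?n) ^ ?m)\<^sup>2 \<le> (\<Sum>x\<in>?V. 1 * ?r x)\<^sup>2"
      using Suc ge0 by (intro power_mono) auto
    \<comment> \<open>Symmetry of A^m turns the sum of its squared row sums into the sum of all
      entries of A^(2m).\<close>
    also have "\<dots> \<le> (\<Sum>x\<in>?V. 1\<^sup>2) * (\<Sum>x\<in>?V. (?r x)\<^sup>2)"
      by (rule Cauchy_Schwarz_ineq_sum)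
    also have "(\<Sum>x\<in>?V. (?r x)\<^sup>2) = (\<Sum>x\<in>?V. \<Sum>u\<in>?V. \<Sum>v\<in>?V. walks T ?m x u * walks T ?m x v)"
      by (simp add: power2_eq_square sum_product)
    also have "\<dots> = (\<Sum>u\<in>?V. \<Sum>x\<in>?V. \<Sum>v\<in>?V. walks T ?m x u * walks T ?m x v)"
      by (rule sum.swap)
    also have "\<dots> = (\<Sum>u\<in>?V. \<Sum>v\<in>?V. \<Sum>x\<in>?V. walks T ?m x u * walks T ?m x v)"
      by (rule sum.cong[OF refl]) (rule sum.swap)
    also have "\<dots> = (\<Sum>u\<in>?V. \<Sum>v\<in>?V. \<Sum>x\<in>?V. walks T ?m u x * walks T ?m x v)"
      using walks_sym[OF assms(1)] by (intro sum.cong) auto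
    also have "\<dots> = (\<Sum>u\<in>?V. \<Sum>v\<in>?V. walks T (2 ^ Suc q) u v)"
      using walks_add[OF fin, of _ ?m ?m] by (intro sum.cong) (auto simp: mult_2)
    finally have "(?n * (walk_moment T 1 / ?n) ^ ?m)\<^sup>2 \<le>
        ?n * (\<Sum>u\<in>?V. \<Sum>v\<in>?V. walks T (2 ^ Suc q) u v)"
      by simp
    moreover have "(?n * (walk_moment T 1 / ?n) ^ ?m)\<^sup>2 =
        ?n * (?n * (walk_moment T 1 / ?n) ^ (2 ^ Suc q))"
      by (simp add: power2_eq_square power_add mult_2)
    ultimately have "?n * (?n * (walk_moment T 1 / ?n) ^ (2 ^ Suc q)) \<le>
        ?n * (\<Sum>u\<in>?V. \<Sum>v\<in>?V. walks T (2 ^ Suc q) u v)"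
      by simp
    then show ?case using n0 by (subst (asm) mult_le_cancel_left_pos) auto
  }
qed

text \<open>One more Cauchy--Schwarz, over all pairs of vertices, compares the entry sum of A^m with
  its Frobenius norm: Sidorenko's inequality for cycles of length 2m, with m a power of two.\<close>

lemma walk_moment_power2_ge:
  assumes "pair_graph T" "pverts T \<noteq> {}"
  shows "walk_moment T (2 ^ q) \<ge> (walk_moment T 1 / real (card (pverts T))) ^ (2 * 2 ^ q)"
proof -
  let ?V = "pverts T"
  let ?n = "real (card ?V)"
  let ?m = "2 ^ q :: nat"
  have fin: "finite ?V" using assms by (simp add: pair_graph_iff)
  then have n0: "?n > 0" using assms(2) by (simp add: card_gt_0_iff)
  have "(?n * (walk_moment T 1 / ?n) ^ ?m)\<^sup>2 \<le> (\<Sum>u\<in>?V. \<Sum>v\<in>?V. walks T ?m u v)\<^sup>2"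
    using walk_total_ge[OF assms] by (intro power_mono) (auto simp: walk_moment_nonneg)
  also have "\<dots> = (\<Sum>e\<in>?V \<times> ?V. 1 * walks T ?m (fst e) (snd e))\<^sup>2"
    by (simp add: sum.cartesian_product case_prod_beta)
  also have "\<dots> \<le> (\<Sum>e\<in>?V \<times> ?V. 1\<^sup>2) * (\<Sum>e\<in>?V \<times> ?V. (walks T ?m (fst e) (snd e))\<^sup>2)"
    by (rule Cauchy_Schwarz_ineq_sum)
  also have "\<dots> = ?n\<^sup>2 * walk_moment T ?m"
    by (simp add: walk_moment_def sum.cartesian_product case_prod_beta card_cartesian_product power2_eq_square)
  finally have "?n\<^sup>2 * (walk_moment T 1 / ?n) ^ (2 * ?m) \<le> ?n\<^sup>2 * walk_moment T ?m"
    by (simp add: power_mult_distrib mult.commute flip: power_mult)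
  then show ?thesis using n0 by (subst (asm) mult_le_cancel_left_pos) auto
qed

text \<open>Log-convexity passes positivity on to the next index, starting from the numbers of
  vertices and arcs. It keeps the logarithms below away from 0.\<close>

lemma walk_moment_pos:
  assumes "pair_graph T" "parcs T \<noteq> {}"
  shows "walk_moment T i > 0"
proof -
  have fin: "finite (pverts T)" "pverts T \<noteq> {}" "finite (parcs T)"
    using assms finite_subset[of "parcs T" "pverts T \<times> pverts T"] by (auto simp: pair_graph_iff)
  have 0: "walk_moment T 0 > 0" using fin by (simp add: walk_moment_0 card_gt_0_iff)
  have 1: "walk_moment T 1 > 0"
    using fin assms by (simp add: walk_moment_1_eq_card[OF assms(1)] card_gt_0_iff del: One_nat_def)
  have "walk_moment T i > 0 \<and> walk_moment T (i + 1) > 0"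
  proof (induction i)
    case (Suc i)
    have "(walk_moment T (i + 1))\<^sup>2 \<le> walk_moment T i * walk_moment T (i + 2)"
      by (rule walk_moment_log_convex[OF assms(1)])
    moreover have "(walk_moment T (i + 1))\<^sup>2 > 0" using Suc by auto
    ultimately have "walk_moment T i * walk_moment T (i + 2) > 0" by linarith
    then show ?case using Suc by (auto simp: zero_less_mult_iff)
  qed (use 0 1 in auto)
  then show ?thesis ..
qed

section \<open>Closed walks and homomorphisms of cycles\<close>

definition walk_set :: "'a pair_pre_digraph \<Rightarrow> nat \<Rightarrow> 'a \<Rightarrow> 'a \<Rightarrow> (nat \<Rightarrow> 'a) set" where
  "walk_set T l u v =
     {f \<in> {..l} \<rightarrow>\<^sub>E pverts T. f 0 = u \<and> f l = v \<and> (\<forall>i<l. (f i, f (Suc i)) \<in> parcs T)}"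

lemma finite_walk_set: "finite (pverts T) \<Longrightarrow> finite (walk_set T l u v)"
  unfolding walk_set_def by (rule finite_subset[of _ "{..l} \<rightarrow>\<^sub>E pverts T"]) (auto intro: finite_PiE)

lemma walk_set_Suc:
  assumes "v \<in> pverts T"
  shows "walk_set T (Suc l) u v =
    (\<Union>x\<in>{x \<in> pverts T. (x, v) \<in> parcs T}. (\<lambda>f. f(Suc l := v)) ` walk_set T l u x)" (is "?A = ?B")
proof (intro set_eqI iffI)
  fix f assume f: "f \<in> ?A"
  let ?g = "restrict f {..l}"
  have "?g \<in> walk_set T l u (f l)" "f l \<in> {x \<in> pverts T. (x, v) \<in> parcs T}"
    using f by (auto simp: walk_set_def PiE_iff)
  moreover have "f = ?g(Suc l := v)"
    using f by (auto simp: walk_set_def PiE_iff extensional_def fun_eq_iff restrict_def)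
  ultimately show "f \<in> ?B" by blast
next
  fix f assume "f \<in> ?B"
  then show "f \<in> ?A"
    using assms by (auto simp: walk_set_def PiE_iff extensional_def less_Suc_eq atMost_Suc)
qed

lemma card_walk_set:
  assumes "finite (pverts T)" "u \<in> pverts T" "v \<in> pverts T"
  shows "real (card (walk_set T l u v)) = walks T l u v"
  using assms(3)
proof (induction l arbitrary: v)
  case 0
  have "walk_set T 0 u v = (if u = v then {\<lambda>x\<in>{..0}. u} else {})"
    using 0 by (auto simp: walk_set_def PiE_iff extensional_def fun_eq_iff)
  then show ?case by simp
next
  case (Suc l)
  let ?N = "{x \<in> pverts T. (x, v) \<in> parcs T}"
  have inj: "inj_on (\<lambda>f. f(Suc l := v)) (walk_set T l u x)" for x
  proof (rule inj_onI)
    fix f g assume *: "f \<in> walk_set T l u x" "g \<in> walk_set T l u x"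
      and eq: "f(Suc l := v) = g(Suc l := v)"
    have "f y = g y" for y
      using fun_cong[OF eq, of y] * by (cases "y = Suc l") (auto simp: walk_set_def PiE_iff extensional_def)
    then show "f = g" ..
  qed
  have "card (walk_set T (Suc l) u v) =
      (\<Sum>x\<in>?N. card ((\<lambda>f. f(Suc l := v)) ` walk_set T l u x))"
    unfolding walk_set_Suc[OF Suc.prems]
  proof (rule card_UN_disjoint)
    show "\<forall>x\<in>?N. \<forall>y\<in>?N. x \<noteq> y \<longrightarrow>
      (\<lambda>f. f(Suc l := v)) ` walk_set T l u x \<inter> (\<lambda>f. f(Suc l := v)) ` walk_set T l u y = {}"
    proof (intro ballI impI equals0I)
      fix x y h assume "x \<noteq> y"
        "h \<in> (\<lambda>f. f(Suc l := v)) ` walk_set T l u x \<inter> (\<lambda>f. f(Suc l := v)) ` walk_set T l u y"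
      then obtain f g where f: "f \<in> walk_set T l u x" "h = f(Suc l := v)"
        and g: "g \<in> walk_set T l u y" "h = g(Suc l := v)"
        by blast
      from f have "h l = x" by (simp add: walk_set_def)
      moreover from g have "h l = y" by (simp add: walk_set_def)
      ultimately have "x = y" by simp
      with \<open>x \<noteq> y\<close> show False by simp
    qed
  qed (use assms(1) in \<open>auto intro: finite_walk_set\<close>)
  also have "\<dots> = (\<Sum>x\<in>?N. card (walk_set T l u x))"
    by (simp add: card_image inj)
  finally have "real (card (walk_set T (Suc l) u v)) = (\<Sum>x\<in>?N. walks T l u x)"
    using Suc.IH by simp
  also have "\<dots> = walks T (Suc l) u v"
    using assms(1) by (auto intro!: sum.mono_neutral_cong_left)
  finally show ?case .
qed

lemma hom_set_cycle_graph:
  assumes "sym (parcs T)"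
  shows "hom_set (cycle_graph m) T =
    {f \<in> {..<m} \<rightarrow>\<^sub>E pverts T. \<forall>i<m. (f i, f ((i + 1) mod m)) \<in> parcs T}"
  using symD[OF assms] by (fastforce simp: hom_set_def cycle_graph_def)

text \<open>A homomorphism closes up to a walk by repeating its first vertex at position m;
  restriction to \<open>{..<m}\<close> is the inverse.\<close>

lemma card_hom_set_cycle_graph:
  assumes "pair_graph T" "m \<ge> 1"
  shows "real (card (hom_set (cycle_graph m) T)) = (\<Sum>u\<in>pverts T. walks T m u u)"
proof -
  have fin: "finite (pverts T)" and sm: "sym (parcs T)"
    using assms by (auto simp: pair_graph_iff)
  have "bij_betw (\<lambda>f. f(m := f 0)) (hom_set (cycle_graph m) T) (\<Union>u\<in>pverts T. walk_set T m u u)"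
  proof (rule bij_betw_byWitness[where f' = "\<lambda>g. restrict g {..<m}"])
    show "\<forall>f\<in>hom_set (cycle_graph m) T. restrict (f(m := f 0)) {..<m} = f"
      by (auto simp: hom_set_cycle_graph[OF sm] PiE_iff extensional_def fun_eq_iff restrict_def)
    show "\<forall>g\<in>\<Union>u\<in>pverts T. walk_set T m u u. (restrict g {..<m})(m := restrict g {..<m} 0) = g"
      using assms(2) by (auto simp: walk_set_def PiE_iff extensional_def fun_eq_iff restrict_def)
    show "(\<lambda>f. f(m := f 0)) ` hom_set (cycle_graph m) T \<subseteq> (\<Union>u\<in>pverts T. walk_set T m u u)"
    proof (rule image_subsetI)
      fix f assume f: "f \<in> hom_set (cycle_graph m) T"
      have "(f i, (f(m := f 0)) (Suc i)) \<in> parcs T" if "i < m" for i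
      proof -
        have "(f i, f ((i + 1) mod m)) \<in> parcs T"
          using f that by (simp add: hom_set_cycle_graph[OF sm])
        then show ?thesis using that by (cases "Suc i = m") auto
      qed
      then have "f(m := f 0) \<in> walk_set T m (f 0) (f 0)" "f 0 \<in> pverts T"
        using f assms(2) by (auto simp: hom_set_cycle_graph[OF sm] walk_set_def PiE_iff extensional_def)
      then show "f(m := f 0) \<in> (\<Union>u\<in>pverts T. walk_set T m u u)" by blast
    qed
    show "(\<lambda>g. restrict g {..<m}) ` (\<Union>u\<in>pverts T. walk_set T m u u) \<subseteq> hom_set (cycle_graph m) T"
    proof (rule image_subsetI)
      fix g assume "g \<in> (\<Union>u\<in>pverts T. walk_set T m u u)"
      then have g: "g \<in> {..m} \<rightarrow>\<^sub>E pverts T" "g m = g 0" "\<And>i. i < m \<Longrightarrow> (g i, g (Suc i)) \<in> parcs T"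
        by (auto simp: walk_set_def)
      have "(restrict g {..<m} i, restrict g {..<m} ((i + 1) mod m)) \<in> parcs T" if "i < m" for i
        using g(2) g(3)[OF that] that by (cases "Suc i = m") auto
      then show "restrict g {..<m} \<in> hom_set (cycle_graph m) T"
        using g(1) by (auto simp: hom_set_cycle_graph[OF sm])
    qed
  qed
  then have "card (hom_set (cycle_graph m) T) = card (\<Union>u\<in>pverts T. walk_set T m u u)"
    by (rule bij_betw_same_card)
  also have "\<dots> = (\<Sum>u\<in>pverts T. card (walk_set T m u u))"
    by (rule card_UN_disjoint) (simp_all add: fin finite_walk_set, auto simp: walk_set_def)
  finally show ?thesis using fin by (simp add: card_walk_set)
qed

lemma hom_density_even_cycle:
  assumes "pair_graph T" "i \<ge> 1"
  shows "hom_density (cycle_graph (2 * i)) T = walk_moment T i / real (card (pverts T)) ^ (2 * i)"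
  using card_hom_set_cycle_graph[of T "2 * i"] assms
  by (simp add: hom_density_def walk_moment_eq_trace cycle_graph_def)

section \<open>The inequalities in logarithmic form\<close>

definition edge_graph :: "'a pair_pre_digraph \<Rightarrow> bool" where
  "edge_graph T \<longleftrightarrow> pair_graph T \<and> parcs T \<noteq> {}"

text \<open>Natural logarithm; the base \<open>1 / t\<close> enters later through division by
  \<open>ln (1 / t)\<close>.\<close>

definition log_cycle_density :: "'a pair_pre_digraph \<Rightarrow> nat \<Rightarrow> real" where
  "log_cycle_density T i = ln (hom_density (cycle_graph (2 * i)) T)"

lemma edge_graph_card_pos: "edge_graph T \<Longrightarrow> card (pverts T) > 0"
  by (auto simp: edge_graph_def pair_graph_iff card_gt_0_iff)

lemma hom_density_even_cycle_pos:
  assumes "edge_graph T" "i \<ge> 1"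
  shows "hom_density (cycle_graph (2 * i)) T > 0"
  using assms edge_graph_card_pos[OF assms(1)] walk_moment_pos[of T i]
  by (simp add: edge_graph_def hom_density_even_cycle)

lemma log_cycle_density_eq:
  assumes "edge_graph T" "i \<ge> 1"
  shows "log_cycle_density T i = ln (walk_moment T i) - 2 * real i * ln (real (card (pverts T)))"
  using assms edge_graph_card_pos[OF assms(1)] walk_moment_pos[of T i]
  by (simp add: edge_graph_def log_cycle_density_def hom_density_even_cycle ln_div ln_realpow)

lemma ln_walk_moment_convex:
  assumes "edge_graph T"
  shows "2 * ln (walk_moment T (i + 1)) \<le> ln (walk_moment T i) + ln (walk_moment T (i + 2))"
proof -
  have pos: "walk_moment T j > 0" "walk_moment T j \<noteq> 0" for j
    using assms walk_moment_pos[of T j] by (auto simp: edge_graph_def)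
  have "ln ((walk_moment T (i + 1))\<^sup>2) \<le> ln (walk_moment T i * walk_moment T (i + 2))"
    using pos walk_moment_log_convex[of T i] assms
    by (subst ln_le_cancel_iff) (auto simp: edge_graph_def simp del: add_2_eq_Suc')
  then show ?thesis
    using pos by (simp add: ln_mult ln_realpow del: add_2_eq_Suc')
qed

text \<open>A convex sequence stays above the line through two consecutive points, since later
  increments are at least the one at i.\<close>

lemma ln_walk_moment_ge_tangent:
  assumes "edge_graph T"
  shows "ln (walk_moment T (i + m)) \<ge>
    ln (walk_moment T i) + real m * (ln (walk_moment T (i + 1)) - ln (walk_moment T i))"
proof -
  define L where "L j = ln (walk_moment T j)" for j
  have "incseq (\<lambda>j. L (Suc j) - L j)"
  proof (rule incseq_SucI)
    show "L (Suc j) - L j \<le> L (Suc (Suc j)) - L (Suc j)" for j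
      using ln_walk_moment_convex[OF assms, of j] by (simp add: L_def)
  qed
  then have inc: "L (Suc i) - L i \<le> L (Suc (i + m)) - L (i + m)" for m
    by (auto simp: incseq_def)
  have "L (i + m) \<ge> L i + real m * (L (i + 1) - L i)"
  proof (induction m)
    case (Suc m)
    then show ?case using inc[of m] by (simp add: algebra_simps)
  qed simp
  then show ?thesis by (simp add: L_def)
qed

text \<open>Submultiplicativity of the Frobenius norm caps the growth rate of the convex sequence
  \<open>ln (walk_moment T i)\<close> on \<open>[l, 2 l]\<close>; this replaces the comparison with the largest eigenvalue.\<close>

lemma ln_walk_moment_norm_Suc:
  assumes "edge_graph T"
  shows "real l * ln (walk_moment T (l + 1)) \<le> real (l + 1) * ln (walk_moment T l)"
proof -
  have pos: "walk_moment T j > 0" "walk_moment T j \<noteq> 0" for j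
    using assms walk_moment_pos[of T j] by (auto simp: edge_graph_def)
  have "ln (walk_moment T (2 * l)) \<le> ln ((walk_moment T l)\<^sup>2)"
    using pos walk_moment_double_le[of T l] assms by (subst ln_le_cancel_iff) (auto simp: edge_graph_def)
  also have "\<dots> = 2 * ln (walk_moment T l)" using pos by (simp add: ln_realpow)
  \<comment> \<open>With L for the logarithm, the tangent at l and the doubling bound give l * (L (l
    + 1) - L l) \<le> L l, which rearranges to the claim.\<close>
  finally show ?thesis
    using ln_walk_moment_ge_tangent[OF assms, of l l, folded mult_2] by (simp add: algebra_simps)
qed

text \<open>Monotonicity of the Schatten norms in cross-multiplied form, chained over consecutive
  indices.\<close>

lemma ln_walk_moment_norm_antimono:
  assumes "edge_graph T" "1 \<le> a" "a \<le> b"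
  shows "real a * ln (walk_moment T b) \<le> real b * ln (walk_moment T a)"
  using assms(3)
proof (induction b rule: dec_induct)
  case (step b)
  have "real b * (real a * ln (walk_moment T (Suc b))) \<le> real a * (real (b + 1) * ln (walk_moment T b))"
    using mult_left_mono[OF ln_walk_moment_norm_Suc[OF assms(1), of b], of "real a"] by (simp add: mult_ac)
  also have "\<dots> = real (b + 1) * (real a * ln (walk_moment T b))" by simp
  also have "\<dots> \<le> real (b + 1) * (real b * ln (walk_moment T a))"
    using step.IH by (rule mult_left_mono) simp
  also have "\<dots> = real b * (real (Suc b) * ln (walk_moment T a))" by simp
  finally show ?case using step.hyps assms(2) by (subst (asm) mult_le_cancel_left_pos) auto
qed simp

text \<open>For a power of two m \<ge> k, the lower bound on \<open>ln (walk_moment T m) / m\<close>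
  does not depend on m; by Schatten monotonicity it carries over to k.\<close>

lemma ln_walk_moment_sidorenko:
  assumes "edge_graph T" "k \<ge> 1"
  shows "ln (walk_moment T k) \<ge>
    2 * real k * (ln (walk_moment T 1) - ln (real (card (pverts T))))"
proof -
  let ?n = "real (card (pverts T))"
  define m :: nat where "m = 2 ^ k"
  have m: "k \<le> m" "m > 0" by (auto simp: m_def intro: less_imp_le)
  have pos: "walk_moment T j > 0" "walk_moment T j \<noteq> 0" for j
    using assms walk_moment_pos[of T j] by (auto simp: edge_graph_def)
  have n0: "?n > 0" using edge_graph_card_pos[OF assms(1)] by simp
  have "real (2 * m) * (ln (walk_moment T 1) - ln ?n) = ln ((walk_moment T 1 / ?n) ^ (2 * m))"
    using pos[of 1] n0 by (simp add: ln_realpow ln_div)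
  also have "\<dots> \<le> ln (walk_moment T m)"
  proof (subst ln_le_cancel_iff)
    have "pverts T \<noteq> {}" using n0 by auto
    then show "(walk_moment T 1 / ?n) ^ (2 * m) \<le> walk_moment T m"
      using walk_moment_power2_ge[of T k] assms(1) by (simp add: edge_graph_def m_def)
  qed (use pos[of 1] pos[of m] n0 in auto)
  finally have "real k * (real (2 * m) * (ln (walk_moment T 1) - ln ?n)) \<le> real k * ln (walk_moment T m)"
    by (rule mult_left_mono) simp
  also have "\<dots> \<le> real m * ln (walk_moment T k)"
    using ln_walk_moment_norm_antimono[OF assms m(1)] .
  finally have "real m * (2 * real k * (ln (walk_moment T 1) - ln ?n)) \<le> real m * ln (walk_moment T k)"
    by (simp add: mult_ac)
  then show ?thesis using m(2) by (subst (asm) mult_le_cancel_left_pos) auto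
qed

text \<open>Passing to densities subtracts a multiple of i, which cancels here and in the norm
  comparison below.\<close>

lemma log_cycle_density_convex:
  assumes "edge_graph T" "i \<ge> 1"
  shows "2 * log_cycle_density T (i + 1) \<le> log_cycle_density T i + log_cycle_density T (i + 2)"
  using ln_walk_moment_convex[OF assms(1), of i] assms
  by (simp add: log_cycle_density_eq algebra_simps del: add_2_eq_Suc')

lemma log_cycle_density_norm_antimono:
  assumes "edge_graph T" "1 \<le> a" "a \<le> b"
  shows "real a * log_cycle_density T b \<le> real b * log_cycle_density T a"
  using ln_walk_moment_norm_antimono[OF assms] assms
  by (simp add: log_cycle_density_eq algebra_simps)

lemma log_cycle_density_sidorenko:
  assumes "edge_graph T" "k \<ge> 1"
  shows "2 * real k * log_cycle_density T 1 \<le> log_cycle_density T k"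
  using ln_walk_moment_sidorenko[OF assms] assms
  by (simp add: log_cycle_density_eq algebra_simps)

text \<open>The tangent at index 0, where the moment is the number of vertices. Equality would mean
  eigenvalues of equal modulus; product graphs come close for short cycles.\<close>

lemma log_cycle_density_ge:
  assumes "edge_graph T" "i \<ge> 1"
  shows "log_cycle_density T i \<ge>
    (1 - real i) * ln (real (card (pverts T))) + real i * log_cycle_density T 1"
  using ln_walk_moment_ge_tangent[OF assms(1), of 0 i] assms
  by (simp add: log_cycle_density_eq walk_moment_0 edge_graph_def pair_graph_iff algebra_simps)

section \<open>The divisor bound\<close>

lemma card_divisors_mult_le:
  assumes "m > 0" "n > (0::nat)"
  shows "card {d. d dvd m * n} \<le> card {d. d dvd m} * card {d. d dvd n}"
proof -
  have fin: "finite {d. d dvd m}" "finite {d. d dvd n}" using assms by auto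
  have "{d. d dvd m * n} \<subseteq> (\<lambda>(a, b). a * b) ` ({d. d dvd m} \<times> {d. d dvd n})"
    by (auto dest!: division_decomp)
  then have "card {d. d dvd m * n} \<le> card ((\<lambda>(a, b). a * b) ` ({d. d dvd m} \<times> {d. d dvd n}))"
    using fin by (intro card_mono) auto
  also have "\<dots> \<le> card ({d. d dvd m} \<times> {d. d dvd n})"
    using fin by (intro card_image_le) auto
  finally show ?thesis by (simp add: card_cartesian_product)
qed

lemma card_divisors_prime_power_le:
  assumes "prime (p::nat)"
  shows "card {d. d dvd p ^ e} \<le> e + 1"
proof -
  have "{d. d dvd p ^ e} \<subseteq> (\<lambda>i. p ^ i) ` {..e}"
    using assms by (auto simp: divides_primepow_nat)
  then have "card {d. d dvd p ^ e} \<le> card ((\<lambda>i. p ^ i) ` {..e})"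
    by (intro card_mono) auto
  also have "\<dots> \<le> card {..e}" by (intro card_image_le) auto
  finally show ?thesis by simp
qed

text \<open>Pays for a small prime q: the divisor factor e + 1 of \<open>q ^ e\<close>, raised to r,
  is at most a constant times \<open>2 ^ e\<close>, hence times \<open>q ^ e\<close>.\<close>

lemma poly_le_const_exp: "\<exists>C\<ge>1. \<forall>e. (real e + 1) ^ r \<le> C * 2 ^ e"
proof -
  have "(\<lambda>e. (real e + 1) ^ r / 2 ^ e) \<longlonglongrightarrow> 0" by real_asymp
  then have "Bseq (\<lambda>e. (real e + 1) ^ r / 2 ^ e)"
    by (intro convergent_imp_Bseq) (auto simp: convergent_def)
  then obtain K where K: "\<And>e. norm ((real e + 1) ^ r / 2 ^ e) \<le> K" by (auto simp: Bseq_def)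
  have "(real e + 1) ^ r \<le> max K 1 * 2 ^ e" for e
  proof -
    have "(real e + 1) ^ r / 2 ^ e \<le> max K 1" using K[of e] by auto
    then show ?thesis by (simp add: divide_simps)
  qed
  then show ?thesis by (intro exI[of _ "max K 1"]) auto
qed

text \<open>Splitting off one prime p at most doubles the number of divisors, and p \<ge>
  \<open>2 ^ r\<close> pays for that in the r-th power.\<close>

lemma card_divisors_power_le_rough:
  assumes "m > 0" "\<And>p. prime p \<Longrightarrow> p dvd m \<Longrightarrow> p \<ge> 2 ^ r"
  shows "card {d. d dvd m} ^ r \<le> (m::nat)"
  using assms
proof (induction m rule: less_induct)
  case (less m)
  show ?case
  proof (cases "m = 1")
    case False
    then obtain p where p: "prime p" "p dvd m" using prime_factor_nat by blast
    then obtain m' where m: "m = p * m'" by (auto elim: dvdE)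
    have m': "m' > 0" "m' < m" using m less.prems(1) prime_gt_1_nat[OF p(1)] by auto
    have IH: "card {d. d dvd m'} ^ r \<le> m'"
      using m m' less.prems(2) by (intro less.IH) auto
    have "card {d. d dvd p} \<le> 2" using card_divisors_prime_power_le[OF p(1), of 1] by simp
    moreover have "card {d. d dvd m} \<le> card {d. d dvd p} * card {d. d dvd m'}"
      unfolding m using m'(1) prime_gt_0_nat[OF p(1)] by (intro card_divisors_mult_le) auto
    ultimately have "card {d. d dvd m} \<le> 2 * card {d. d dvd m'}"
      by (meson le_trans mult_le_mono1)
    then have "card {d. d dvd m} ^ r \<le> (2 * card {d. d dvd m'}) ^ r" by (rule power_mono) simp
    also have "\<dots> = 2 ^ r * card {d. d dvd m'} ^ r" by (simp add: power_mult_distrib)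
    also have "\<dots> \<le> p * m'" using IH less.prems(2)[OF p] by (intro mult_mono) auto
    finally show ?thesis using m by simp
  qed simp
qed

text \<open>The primes below \<open>2 ^ r\<close> are split off one at a time, each contributing a bounded factor.\<close>

lemma card_divisors_power_le:
  "\<exists>C\<ge>1. \<forall>m>0. real (card {d. d dvd m}) ^ r \<le> C * real m"
proof -
  obtain B where B: "B \<ge> 1" "\<And>e. (real e + 1) ^ r \<le> B * 2 ^ e" using poly_le_const_exp by blast
  \<comment> \<open>Each step lowers the threshold \<open>2 ^ r - n\<close> for the prime factors by
    one, written additively to avoid truncation; at n = \<open>2 ^ r\<close> the condition is
    void.\<close>
  have "\<exists>C\<ge>1. \<forall>m>0. (\<forall>p. prime p \<longrightarrow> p dvd m \<longrightarrow> p + n \<ge> 2 ^ r) \<longrightarrow>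
      real (card {d. d dvd m}) ^ r \<le> C * real m" for n
  proof (induction n)
    case 0
    have "real (card {d. d dvd m}) ^ r \<le> 1 * real m"
      if "m > 0" "\<forall>p. prime p \<longrightarrow> p dvd m \<longrightarrow> p + 0 \<ge> 2 ^ r" for m
    proof -
      have "card {d. d dvd m} ^ r \<le> m" using that by (intro card_divisors_power_le_rough) auto
      then have "real (card {d. d dvd m} ^ r) \<le> real m" by (rule of_nat_mono)
      then show ?thesis by simp
    qed
    then show ?case by (intro exI[of _ 1]) auto
  next
    case (Suc n)
    then obtain C where C: "C \<ge> 1" "\<And>m. m > 0 \<Longrightarrow> (\<forall>p. prime p \<longrightarrow> p dvd m \<longrightarrow> p + n \<ge> 2 ^ r) \<Longrightarrow>
      real (card {d. d dvd m}) ^ r \<le> C * real m" by blast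
    \<comment> \<open>The only prime factor that the weaker condition can newly admit. Truncation
      makes it 0, hence not prime, once \<open>Suc n\<close> reaches \<open>2 ^ r\<close>.\<close>
    define q :: nat where "q = 2 ^ r - Suc n"
    have bound: "real (card {d. d dvd m}) ^ r \<le> B * C * real m"
      if m: "m > 0" and h: "\<forall>p. prime p \<longrightarrow> p dvd m \<longrightarrow> p + Suc n \<ge> 2 ^ r" for m
    proof (cases "prime q")
      case False
      have "p + n \<ge> 2 ^ r" if "prime p" "p dvd m" for p
      proof -
        have "p \<noteq> q" "p + Suc n \<ge> 2 ^ r" using False h that by auto
        then show ?thesis unfolding q_def by linarith
      qed
      then have "real (card {d. d dvd m}) ^ r \<le> C * real m" using C(2) m by blast
      also have "\<dots> \<le> B * (C * real m)"
        using B(1) C(1) mult_right_mono[of 1 B "C * real m"] by simp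
      finally show ?thesis by (simp add: mult.assoc)
    next
      case True
      \<comment> \<open>The full power of q is stripped, so that the cofactor meets the old
        condition.\<close>
      then have "\<not> is_unit q" by auto
      with m obtain e m' where m': "m = q ^ e * m'" "\<not> q dvd m'"
        using multiplicity_decompose'[of m q] by (metis neq0_conv)
      have m'0: "m' > 0" using m'(2) by (cases m') auto
      have q0: "q ^ e > 0" using True prime_gt_0_nat by auto
      have "p + n \<ge> 2 ^ r" if "prime p" "p dvd m'" for p
      proof -
        have "p \<noteq> q" using m' that by auto
        moreover have "p + Suc n \<ge> 2 ^ r" using h that m'(1) by (metis dvd_mult)
        ultimately show ?thesis unfolding q_def by linarith
      qed
      then have IH: "real (card {d. d dvd m'}) ^ r \<le> C * real m'" using C(2) m'0 by blast
      have "card {d. d dvd m} \<le> (e + 1) * card {d. d dvd m'}"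
        using order.trans[OF card_divisors_mult_le[OF q0 m'0]
            mult_le_mono1[OF card_divisors_prime_power_le[OF True, of e]]]
        unfolding m'(1) .
      then have "real (card {d. d dvd m}) \<le> real ((e + 1) * card {d. d dvd m'})" by (rule of_nat_mono)
      then have "real (card {d. d dvd m}) ^ r \<le> ((real e + 1) * real (card {d. d dvd m'})) ^ r"
        by (intro power_mono) (auto simp: algebra_simps)
      also have "\<dots> = (real e + 1) ^ r * real (card {d. d dvd m'}) ^ r" by (rule power_mult_distrib)
      also have "\<dots> \<le> (B * 2 ^ e) * (C * real m')"
        using B IH by (intro mult_mono) auto
      also have "\<dots> \<le> (B * real q ^ e) * (C * real m')"
        using B(1) C(1) prime_ge_2_nat[OF True]
        by (intro mult_right_mono mult_left_mono power_mono) auto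
      also have "\<dots> = B * C * real (q ^ e * m')" by simp
      finally show ?thesis unfolding m'(1) .
    qed
    have "B * C \<ge> 1" using B(1) C(1) mult_mono[of 1 B 1 C] by simp
    with bound show ?case by blast
  qed
  from this[of "2 ^ r"] show ?thesis by auto
qed

section \<open>Product graphs modulo a prime\<close>

text \<open>For prime P and x < P this is, up to removed loops, the Cayley sum graph of the
  multiplicative group modulo P with connection set \<open>{1..x}\<close>.\<close>

definition product_graph :: "nat \<Rightarrow> nat \<Rightarrow> nat pair_pre_digraph" where
  "product_graph P x =
     \<lparr> pverts = {1..<P},
       parcs = {(u, v). u \<in> {1..<P} \<and> v \<in> {1..<P} \<and> u \<noteq> v \<and> u * v mod P \<le> x} \<rparr>"

lemma pair_graph_product_graph: "pair_graph (product_graph P x)"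
  by (auto simp: pair_graph_iff product_graph_def sym_def irrefl_def mult.commute)

lemma mult_mod_prime_nonzero:
  assumes "prime (P::nat)" "u \<in> {1..<P}" "v \<in> {1..<P}"
  shows "u * v mod P \<in> {1..<P}"
proof -
  have "\<not> P dvd u * v" using assms by (auto simp: prime_dvd_mult_iff dest: dvd_imp_le)
  then show ?thesis using assms(2) by (auto simp: dvd_eq_mod_eq_0 Suc_le_eq intro: Nat.gr0I)
qed

lemma inj_on_mult_mod_prime:
  assumes "prime (P::nat)" "u \<in> {1..<P}"
  shows "inj_on (\<lambda>v. u * v mod P) {1..<P}"
proof (rule inj_onI)
  fix v w assume v: "v \<in> {1..<P}" and w: "w \<in> {1..<P}" and eq: "u * v mod P = u * w mod P"
  have "\<not> P dvd u" using assms(2) by (auto dest: dvd_imp_le)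
  then have "coprime u P" using assms(1) prime_imp_coprime coprime_commute by blast
  then have "[v = w] (mod P)" using eq cong_mult_lcancel_nat[of u P v w] by (simp add: cong_def)
  then show "v = w" using v w by (simp add: cong_def)
qed

text \<open>Multiplication by u permutes the nonzero residues, so u has at least x partners; one is
  given up for a possible loop at u.\<close>

lemma card_parcs_product_graph_ge:
  assumes "prime P" "x < P"
  shows "card (parcs (product_graph P x)) \<ge> (P - 1) * (x - 1)"
proof -
  let ?V = "{1..<P}"
  let ?N = "\<lambda>u. {v \<in> ?V. u * v mod P \<le> x}"
  have N: "card (?N u) \<ge> x" if u: "u \<in> ?V" for u
  proof -
    have surj: "(\<lambda>v. u * v mod P) ` ?V = ?V"
      using inj_on_mult_mod_prime[OF assms(1) u] mult_mod_prime_nonzero[OF assms(1) u]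
      by (intro endo_inj_surj) auto
    have "{1..x} \<subseteq> (\<lambda>v. u * v mod P) ` ?N u"
    proof
      fix y assume y: "y \<in> {1..x}"
      then have "y \<in> (\<lambda>v. u * v mod P) ` ?V" unfolding surj using assms(2) by auto
      then obtain v where "v \<in> ?V" "y = u * v mod P" by blast
      then show "y \<in> (\<lambda>v. u * v mod P) ` ?N u" using y by auto
    qed
    then have "card {1..x} \<le> card ((\<lambda>v. u * v mod P) ` ?N u)" by (intro card_mono) auto
    also have "\<dots> \<le> card (?N u)" by (intro card_image_le) auto
    finally show ?thesis by simp
  qed
  have "(P - 1) * (x - 1) = (\<Sum>u\<in>?V. x - 1)" by simp
  also have "\<dots> \<le> (\<Sum>u\<in>?V. card (?N u - {u}))"
  proof (rule sum_mono)
    fix u assume "u \<in> ?V"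
    then show "x - 1 \<le> card (?N u - {u})"
      using N[of u] diff_card_le_card_Diff[of "{u}" "?N u"] by simp
  qed
  also have "\<dots> = card (Sigma ?V (\<lambda>u. ?N u - {u}))" by (rule card_SigmaI[symmetric]) auto
  also have "Sigma ?V (\<lambda>u. ?N u - {u}) = parcs (product_graph P x)"
    by (auto simp: product_graph_def)
  finally show ?thesis .
qed

text \<open>A closed walk is determined by its starting vertex and the residues of the products along its
  edges. The products over the even and the odd edges are congruent modulo \<open>P\<close>, and, being
  smaller than \<open>P\<close>, equal: the odd residues divide the product of the even ones.\<close>

lemma card_hom_set_product_graph_le:
  assumes P: "prime P" and i: "i \<ge> 1" and x: "x ^ i < P"
  shows "card (hom_set (cycle_graph (2 * i)) (product_graph P x)) \<le>
    (P - 1) * (\<Sum>c\<in>{..<i} \<rightarrow>\<^sub>E {1..x}. card {d. d dvd (\<Prod>l<i. c l)} ^ i)"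
proof -
  let ?V = "{1..<P}"
  let ?H = "hom_set (cycle_graph (2 * i)) (product_graph P x)"
  let ?D = "\<lambda>c. {..<i} \<rightarrow>\<^sub>E {d. d dvd (\<Prod>l<i. c l)}"
  let ?C = "{..<i} \<rightarrow>\<^sub>E {1..x}"
  \<comment> \<open>\<open>a f l\<close> is the residue on edge l, where the last edge wraps around
    to \<open>f 0\<close>; \<Phi> records the start and the residues on even and odd edges.\<close>
  define a where "a f l = f l * f ((l + 1) mod (2 * i)) mod P" for f :: "nat \<Rightarrow> nat" and l
  define \<Phi> where "\<Phi> f = (f 0, \<lambda>l\<in>{..<i}. a f (2 * l), \<lambda>l\<in>{..<i}. a f (2 * l + 1))" for f
  have sm: "sym (parcs (product_graph P x))" using pair_graph_product_graph by (simp add: pair_graph_iff)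
  have fV: "f l \<in> ?V" if "f \<in> ?H" "l < 2 * i" for f l
    using that unfolding hom_set_cycle_graph[OF sm] by (auto simp: product_graph_def PiE_iff)
  have aV: "a f l \<in> {1..x}" if "f \<in> ?H" "l < 2 * i" for f l
  proof -
    have "(f l, f ((l + 1) mod (2 * i))) \<in> parcs (product_graph P x)"
      using that unfolding hom_set_cycle_graph[OF sm] by blast
    then have "a f l \<le> x" "a f l \<in> ?V"
      using mult_mod_prime_nonzero[OF P] by (auto simp: product_graph_def a_def)
    then show ?thesis by auto
  qed
  have prod_eq: "(\<Prod>l<i. a f (2 * l + 1)) = (\<Prod>l<i. a f (2 * l))" if f: "f \<in> ?H" for f
  proof -
    have lt: "(\<Prod>l<i. a f (g l)) < P" if "\<And>l. l < i \<Longrightarrow> g l < 2 * i" for g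
    proof -
      have "(\<Prod>l<i. a f (g l)) \<le> (\<Prod>l<i. x)" using aV[OF f] that by (intro prod_mono) auto
      also have "\<dots> = x ^ i" by simp
      finally show ?thesis using x by simp
    qed
    \<comment> \<open>Odd edges pair position 2l + 1 with 2l + 2, so the even positions enter
      rotated by one.\<close>
    have shift: "(\<Prod>l<i. f ((2 * l + 2) mod (2 * i))) = (\<Prod>l<i. f (2 * l))"
    proof -
      obtain j where j: "i = Suc j" using i by (cases i) auto
      have "(\<Prod>l<i. f ((2 * l + 2) mod (2 * i))) = (\<Prod>l<j. f ((2 * l + 2) mod (2 * i))) * f 0"
        by (simp add: j)
      also have "(\<Prod>l<j. f ((2 * l + 2) mod (2 * i))) = (\<Prod>l<j. f (2 * Suc l))"
        by (intro prod.cong) (auto simp: j)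
      also have "\<dots> * f 0 = (\<Prod>l<i. f (2 * l))"
        unfolding j prod.lessThan_Suc_shift by simp
      finally show ?thesis .
    qed
    have "(\<Prod>l<i. a f (2 * l + 1)) mod P = (\<Prod>l<i. f (2 * l + 1) * f ((2 * l + 2) mod (2 * i))) mod P"
      by (simp add: a_def mod_prod_eq)
    also have "(\<Prod>l<i. f (2 * l + 1) * f ((2 * l + 2) mod (2 * i))) = (\<Prod>l<i. f (2 * l) * f (2 * l + 1))"
      unfolding prod.distrib shift by (rule mult.commute)
    also have "\<dots> = (\<Prod>l<i. f (2 * l) * f ((2 * l + 1) mod (2 * i)))"
      by (intro prod.cong) auto
    also have "\<dots> mod P = (\<Prod>l<i. a f (2 * l)) mod P"
      by (simp add: a_def mod_prod_eq)
    finally show ?thesis using lt[of "\<lambda>l. 2 * l + 1"] lt[of "\<lambda>l. 2 * l"] by simp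
  qed
  have inj: "inj_on \<Phi> ?H"
  proof (rule inj_onI)
    fix f g assume f: "f \<in> ?H" and g: "g \<in> ?H" and eq: "\<Phi> f = \<Phi> g"
    have f0: "f 0 = g 0" using eq by (simp add: \<Phi>_def)
    have ev: "a f (2 * l) = a g (2 * l)" and od: "a f (2 * l + 1) = a g (2 * l + 1)" if "l < i" for l
      using eq that by (auto simp: \<Phi>_def fun_eq_iff restrict_def split: if_splits)
    have aeq: "a f l = a g l" if "l < 2 * i" for l
    proof (cases "even l")
      case True
      then show ?thesis using ev[of "l div 2"] that by auto
    next
      case False
      then show ?thesis using od[of "l div 2"] that by (auto elim!: oddE)
    qed
    \<comment> \<open>As \<open>f l\<close> is invertible modulo P, it determines
      \<open>f (Suc l)\<close> together with the residue on edge l.\<close>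
    have "f l = g l" if "l < 2 * i" for l
      using that
    proof (induction l)
      case (Suc l)
      have "f l * f (Suc l) mod P = f l * g (Suc l) mod P"
        using aeq[of l] Suc by (simp add: a_def)
      moreover have "f l \<in> ?V" "f (Suc l) \<in> ?V" "g (Suc l) \<in> ?V"
        using fV f g Suc.prems by auto
      ultimately show ?case using inj_onD[OF inj_on_mult_mod_prime[OF P, of "f l"]] by blast
    qed (use f0 in simp)
    then show "f = g"
      using f g unfolding hom_set_cycle_graph[OF sm] by (auto intro: PiE_ext)
  qed
  have into: "\<Phi> ` ?H \<subseteq> ?V \<times> Sigma ?C ?D"
  proof (rule image_subsetI)
    fix f assume f: "f \<in> ?H"
    have "a f (2 * l + 1) dvd (\<Prod>l<i. a f (2 * l))" if "l < i" for l
      using that unfolding prod_eq[OF f, symmetric] by (intro dvd_prodI) auto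
    then show "\<Phi> f \<in> ?V \<times> Sigma ?C ?D"
      using f i fV[OF f, of 0] aV[OF f] by (auto simp: \<Phi>_def)
  qed
  have pos: "(\<Prod>l<i. c l) > 0" if "c \<in> ?C" for c
    using that by (intro prod_pos) (auto simp: PiE_iff Suc_le_eq)
  have finC: "finite ?C" by (intro finite_PiE) auto
  have finD: "finite (?D c)" if "c \<in> ?C" for c
    using pos[OF that] by (intro finite_PiE) auto
  have "card ?H = card (\<Phi> ` ?H)" using inj by (simp add: card_image)
  also have "\<dots> \<le> card (?V \<times> Sigma ?C ?D)"
    using into finC finD by (intro card_mono finite_cartesian_product finite_SigmaI) auto
  also have "\<dots> = (P - 1) * (\<Sum>c\<in>?C. card (?D c))"
    using finC finD by (simp add: card_cartesian_product)
  finally show ?thesis by (simp add: card_PiE)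
qed

text \<open>There are \<open>x ^ i\<close> tuples c, and each product is at most
  \<open>x ^ i\<close>, so K bounds its number of divisors uniformly.\<close>

lemma walk_moment_product_graph_le:
  assumes P: "prime P" and i: "i \<ge> 1" and x: "x ^ i < P"
    and K: "\<And>y. 0 < y \<Longrightarrow> y \<le> x ^ i \<Longrightarrow> real (card {d. d dvd y}) \<le> K"
  shows "walk_moment (product_graph P x) i \<le> real (P - 1) * (real x ^ i * K ^ i)"
proof -
  let ?C = "{..<i} \<rightarrow>\<^sub>E {1..x}"
  have "walk_moment (product_graph P x) i =
      real (card (hom_set (cycle_graph (2 * i)) (product_graph P x)))"
    using card_hom_set_cycle_graph[OF pair_graph_product_graph, of "2 * i"] i
    by (simp add: walk_moment_eq_trace[OF pair_graph_product_graph])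
  also have "\<dots> \<le> real ((P - 1) * (\<Sum>c\<in>?C. card {d. d dvd (\<Prod>l<i. c l)} ^ i))"
    using card_hom_set_product_graph_le[OF P i x] by (rule of_nat_mono)
  also have "\<dots> = real (P - 1) * (\<Sum>c\<in>?C. real (card {d. d dvd (\<Prod>l<i. c l)}) ^ i)"
    by simp
  also have "\<dots> \<le> real (P - 1) * (\<Sum>c\<in>?C. K ^ i)"
  proof (intro mult_left_mono sum_mono power_mono K)
    fix c assume c: "c \<in> ?C"
    show "0 < (\<Prod>l<i. c l)" using c by (intro prod_pos) (auto simp: PiE_iff Suc_le_eq)
    have "(\<Prod>l<i. c l) \<le> (\<Prod>l<i. x)" using c by (intro prod_mono) (auto simp: PiE_iff)
    then show "(\<Prod>l<i. c l) \<le> x ^ i" by simp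
  qed auto
  also have "\<dots> = real (P - 1) * (real x ^ i * K ^ i)" by (simp add: card_PiE)
  finally show ?thesis .
qed

text \<open>If \<open>P\<close> is about \<open>x ^ j\<close>, the graph behaves as if it had one eigenvalue \<open>x\<close> and about
  \<open>P\<close> eigenvalues of size \<open>sqrt x\<close>, so that the density of the \<open>2 i\<close>-cycle has order
  \<open>max (x ^ (2 * i)) (P * x ^ i) / P ^ (2 * i)\<close>; \<open>ray j i\<close> is the exponent of \<open>x\<close>.\<close>

definition ray :: "nat \<Rightarrow> nat \<Rightarrow> real" where
  "ray j i = real i + max (real i) (real j) - 2 * real i * real j"

lemma edge_graph_product_graph:
  assumes "prime P" "2 \<le> x" "x < P"
  shows "edge_graph (product_graph P x)"
proof -
  have "0 < (P - 1) * (x - 1)" using assms by simp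
  then have "card (parcs (product_graph P x)) > 0"
    using card_parcs_product_graph_ge[OF assms(1,3)] by linarith
  then show ?thesis using pair_graph_product_graph by (auto simp: edge_graph_def)
qed

text \<open>The window for P makes \<open>ln (P - 1)\<close> equal to j * ln x up to j * ln 2. Lower
  bounds: the tangent at index 0 for i \<le> j, Sidorenko for i > j. Upper bounds: counting for i
  \<le> j, Schatten monotonicity from j on for i > j.\<close>

lemma log_cycle_density_product_graph:
  assumes P: "prime P" and j: "j \<ge> 1" and x: "x \<ge> 2" "x ^ j < P" "P \<le> (x + 1) ^ j"
    and K: "K \<ge> 1" "\<And>y. 0 < y \<Longrightarrow> y \<le> x ^ j \<Longrightarrow> real (card {d. d dvd y}) \<le> K"
    and i: "i \<ge> 1"
  shows "log_cycle_density (product_graph P x) i \<ge> ln (real x) * ray j i - 4 * real i * real j"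
    and "log_cycle_density (product_graph P x) i \<le> ln (real x) * ray j i + real i * ln K"
proof -
  let ?G = "product_graph P x"
  let ?L = "log_cycle_density ?G"
  define \<xi> where "\<xi> = ln (real x)"
  define \<nu> where "\<nu> = ln (real (P - 1))"
  have "x ^ 1 \<le> x ^ j" using x(1) j by (intro power_increasing) auto
  then have xP: "x < P" using x(2) by simp
  have eg: "edge_graph ?G" by (rule edge_graph_product_graph[OF P x(1) xP])
  have n: "real (card (pverts ?G)) = real (P - 1)" by (simp add: product_graph_def)
  have P1: "real (P - 1) > 0" using prime_gt_1_nat[OF P] by simp
  have l2: "ln 2 \<le> (1::real)" using ln_add_one_self_le_self[of 1] by simp
  have nu_lower: "\<nu> \<ge> real j * \<xi>"
  proof -
    have "x ^ j \<le> P - 1" using x(2) by simp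
    then have "real (x ^ j) \<le> real (P - 1)" by (rule of_nat_mono)
    then have "ln (real x ^ j) \<le> \<nu>" unfolding \<nu>_def using P1 x(1) by (subst ln_le_cancel_iff) auto
    then show ?thesis using x(1) by (simp add: ln_realpow \<xi>_def)
  qed
  have nu_upper: "\<nu> \<le> real j * (\<xi> + ln 2)"
  proof -
    have "(x + 1) ^ j \<le> (2 * x) ^ j" using x(1) by (intro power_mono) auto
    then have "P - 1 \<le> (2 * x) ^ j" using x(3) by linarith
    then have "real (P - 1) \<le> real ((2 * x) ^ j)" by (rule of_nat_mono)
    then have "\<nu> \<le> ln ((2 * real x) ^ j)" unfolding \<nu>_def using P1 x(1) by (subst ln_le_cancel_iff) auto
    also have "\<dots> = real j * (\<xi> + ln 2)" using x(1) by (simp add: ln_realpow ln_mult \<xi>_def algebra_simps)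
    finally show ?thesis .
  qed
  \<comment> \<open>Since x \<ge> 2, the degree bound x - 1 is at least x / 2, which costs ln
    2.\<close>
  have L1: "?L 1 \<ge> \<xi> - ln 2 - \<nu>"
  proof -
    have "real (P - 1) * (real x / 2) \<le> real (P - 1) * real (x - 1)"
      using x(1) by (intro mult_left_mono) (auto simp: of_nat_diff)
    also have "\<dots> \<le> walk_moment ?G 1"
      using of_nat_mono[OF card_parcs_product_graph_ge[OF P xP], where 'a = real]
      by (simp only: walk_moment_1_eq_card[OF pair_graph_product_graph] of_nat_mult)
    finally have "ln (real (P - 1) * (real x / 2)) \<le> ln (walk_moment ?G 1)"
      using P1 x(1) eg walk_moment_pos[of ?G 1] by (subst ln_le_cancel_iff) (auto simp: edge_graph_def)
    moreover have "ln (real (P - 1) * (real x / 2)) = \<nu> + \<xi> - ln 2"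
      using P1 x(1) by (simp add: ln_mult ln_div \<nu>_def \<xi>_def)
    ultimately show ?thesis unfolding log_cycle_density_eq[OF eg order.refl] n \<nu>_def by simp
  qed
  show "?L i \<ge> ln (real x) * ray j i - 4 * real i * real j"
  proof (cases "i \<le> j")
    case True
    have "\<xi> * ray j i - 4 * real i * real j = (1 - 2 * real i) * (real j * \<xi>) + real i * \<xi> - 4 * real i * real j"
      using True by (simp add: ray_def max_def algebra_simps)
    also have "\<dots> \<le> (1 - 2 * real i) * (real j * (\<xi> + ln 2)) + real i * (\<xi> - ln 2)"
    proof -
      have "ln 2 * ((2 * real i - 1) * real j + real i) \<le> 1 * ((2 * real i - 1) * real j + real i)"
        using l2 i by (intro mult_right_mono add_nonneg_nonneg mult_nonneg_nonneg) auto
      also have "\<dots> \<le> 4 * real i * real j"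
      proof -
        have "real i * 1 \<le> real i * real j" using j by (intro mult_left_mono) auto
        moreover have "real i * real j \<ge> 0" by simp
        ultimately show ?thesis by (simp add: algebra_simps)
      qed
      finally show ?thesis by (simp add: algebra_simps)
    qed
    \<comment> \<open>The factor \<open>1 - 2 * real i\<close> is negative, so the upper bound on
      \<nu> yields a lower bound here.\<close>
    also have "\<dots> \<le> (1 - 2 * real i) * \<nu> + real i * (\<xi> - ln 2)"
      using mult_left_mono_neg[OF nu_upper, of "1 - 2 * real i"] i by simp
    also have "\<dots> = (1 - real i) * \<nu> + real i * (\<xi> - ln 2 - \<nu>)" by (simp add: algebra_simps)
    also have "\<dots> \<le> (1 - real i) * \<nu> + real i * ?L 1"
      using mult_left_mono[OF L1, of "real i"] by simp
    also have "\<dots> \<le> ?L i" using log_cycle_density_ge[OF eg i] unfolding n \<nu>_def .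
    finally show ?thesis by (simp add: \<xi>_def)
  next
    case False
    have "\<xi> * ray j i - 4 * real i * real j = 2 * real i * (\<xi> - real j * \<xi>) - 4 * real i * real j"
      using False by (simp add: ray_def max_def algebra_simps)
    also have "\<dots> \<le> 2 * real i * (\<xi> - ln 2 - real j * (\<xi> + ln 2))"
    proof -
      have "ln 2 * (2 * real i + 2 * real i * real j) \<le> 1 * (2 * real i + 2 * real i * real j)"
        using l2 by (intro mult_right_mono) auto
      also have "\<dots> \<le> 4 * real i * real j"
        using mult_left_mono[of 1 "real j" "real i"] j by simp
      finally show ?thesis by (simp add: algebra_simps)
    qed
    also have "\<dots> \<le> 2 * real i * ?L 1"
      using L1 nu_upper by (intro mult_left_mono) auto
    also have "\<dots> \<le> ?L i" by (rule log_cycle_density_sidorenko[OF eg i])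
    finally show ?thesis by (simp add: \<xi>_def)
  qed
  \<comment> \<open>Stated for a fresh i, since the case i > j below uses it at j.\<close>
  have upper: "?L i \<le> \<xi> * (real j + real i - 2 * real i * real j) + real i * ln K"
    if i: "i \<ge> 1" "i \<le> j" for i
  proof -
    have le: "x ^ i \<le> x ^ j" using x(1) i by (intro power_increasing) auto
    have "walk_moment ?G i \<le> real (P - 1) * (real x ^ i * K ^ i)"
      using le x(2) K(2) i by (intro walk_moment_product_graph_le[OF P]) auto
    then have "ln (walk_moment ?G i) \<le> ln (real (P - 1) * (real x ^ i * K ^ i))"
      using P1 x(1) K(1) eg walk_moment_pos[of ?G i] by (subst ln_le_cancel_iff) (auto simp: edge_graph_def)
    also have "\<dots> = \<nu> + real i * \<xi> + real i * ln K"
      using P1 x(1) K(1) by (simp add: ln_mult ln_realpow \<nu>_def \<xi>_def)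
    finally have "?L i \<le> (1 - 2 * real i) * \<nu> + real i * \<xi> + real i * ln K"
      unfolding log_cycle_density_eq[OF eg i(1)] n \<nu>_def[symmetric] by (simp add: algebra_simps)
    also have "\<dots> \<le> (1 - 2 * real i) * (real j * \<xi>) + real i * \<xi> + real i * ln K"
      using mult_left_mono_neg[OF nu_lower, of "1 - 2 * real i"] i by simp
    finally show ?thesis by (simp add: algebra_simps)
  qed
  show "?L i \<le> ln (real x) * ray j i + real i * ln K"
  proof (cases "i \<le> j")
    case True
    then show ?thesis using upper[OF i] by (simp add: ray_def max_def algebra_simps \<xi>_def)
  next
    case False
    \<comment> \<open>Beyond j the products may exceed P and the counting argument breaks down; the
      norm comparison extends the bound from j.\<close>
    have "real j * ?L i \<le> real i * ?L j"
      using False by (intro log_cycle_density_norm_antimono[OF eg j]) auto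
    also have "\<dots> \<le> real i * (\<xi> * (real j + real j - 2 * real j * real j) + real j * ln K)"
      using upper[OF j order.refl] by (intro mult_left_mono) auto
    also have "\<dots> = real j * (\<xi> * ray j i + real i * ln K)"
      using False by (simp add: ray_def max_def algebra_simps)
    finally have "?L i \<le> \<xi> * ray j i + real i * ln K"
      using j by (subst (asm) mult_le_cancel_left_pos) auto
    then show ?thesis by (simp add: \<xi>_def)
  qed
qed

section \<open>Graphs approximating the extreme rays\<close>

definition approximable :: "nat \<Rightarrow> (nat \<Rightarrow> real) \<Rightarrow> bool" where
  "approximable k r \<longleftrightarrow> (\<forall>\<epsilon>>0. \<exists>(T :: nat pair_pre_digraph) X. edge_graph T \<and> X > 0 \<and>
     (\<forall>i\<in>{1..k}. \<bar>log_cycle_density T i / X - r i\<bar> \<le> \<epsilon>))"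

text \<open>Errors are measured relative to X = ln x. First r is chosen to make the share of the
  divisor bound small, then a large x absorbs all constants.\<close>

lemma approximable_ray:
  assumes j: "j \<ge> 1"
  shows "approximable k (ray j)"
  unfolding approximable_def
proof (intro allI impI)
  fix \<epsilon> :: real assume eps: "\<epsilon> > 0"
  \<comment> \<open>The divisor bound adds about i * j / r to the exponent of x; this r keeps that
    at most \<epsilon> / 2 for i \<le> k.\<close>
  obtain r0 :: nat where r0: "real r0 > 2 * real k * real j / \<epsilon>" using reals_Archimedean2 by blast
  define r where "r = Suc r0"
  have r: "r \<ge> 1" "real k * real j / real r \<le> \<epsilon> / 2"
  proof -
    have "real r > 2 * real k * real j / \<epsilon>" using r0 by (simp add: r_def)
    then show "real k * real j / real r \<le> \<epsilon> / 2" using eps by (simp add: r_def field_simps)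
  qed (simp add: r_def)
  obtain C where C: "C \<ge> 1" "\<And>m. m > 0 \<Longrightarrow> real (card {d. d dvd m}) ^ r \<le> C * real m"
    using card_divisors_power_le[of r] by blast
  \<comment> \<open>Lower bounds for ln x: the 1 ensures x \<ge> 2, the next absorbs the additive
    error 4 * i * j, the last the constant C.\<close>
  define B where "B = max 1 (max (4 * real k * real j / \<epsilon>) (2 * real k * ln C / \<epsilon>))"
  obtain x0 :: nat where x0: "real x0 > exp B" using reals_Archimedean2 by blast
  obtain P where P: "prime P" "P > (x0 + 1) ^ j" using bigger_prime by blast
  have ex: "\<exists>x. P \<le> (x + 1) ^ j"
    using j by (intro exI[of _ P]) (metis le_add1 order.trans power_increasing power_one_right le_add2)
  \<comment> \<open>The prime comes first and x is fitted to it; minimality yields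
    \<open>x ^ j < P\<close>.\<close>
  define x where "x = (LEAST x. P \<le> (x + 1) ^ j)"
  have xub: "P \<le> (x + 1) ^ j" unfolding x_def using ex by (rule LeastI_ex)
  have x0x: "x0 < x"
  proof (rule ccontr)
    assume "\<not> x0 < x"
    then have "(x + 1) ^ j \<le> (x0 + 1) ^ j" by (intro power_mono) auto
    then show False using xub P(2) by simp
  qed
  have xlb: "x ^ j < P"
    using not_less_Least[of "x - 1" "\<lambda>x. P \<le> (x + 1) ^ j"] x0x by (simp add: x_def)
  define X where "X = ln (real x)"
  have "exp B < real x" using x0 x0x by linarith
  then have BX: "B < X"
    unfolding X_def by (metis exp_gt_zero exp_less_cancel_iff exp_ln less_trans)
  have X: "X > 1" "4 * real k * real j / \<epsilon> \<le> X" "2 * real k * ln C / \<epsilon> \<le> X"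
    using BX by (auto simp: B_def)
  have "1 < exp B" by (simp add: B_def)
  then have x2: "x \<ge> 2" using x0 x0x by linarith
  define K where "K = root r (C * real x ^ j)"
  have Cx: "C * real x ^ j \<ge> 1"
    using C(1) x2 mult_mono[of 1 C 1 "real x ^ j"] by simp
  have K1: "K \<ge> 1" using Cx r by (simp add: K_def real_root_ge_1_iff)
  have Kd: "real (card {d. d dvd y}) \<le> K" if "0 < y" "y \<le> x ^ j" for y
  proof -
    have "real (card {d. d dvd y}) ^ r \<le> C * real (x ^ j)"
      using C(1) that by (intro order.trans[OF C(2)] mult_left_mono of_nat_mono) auto
    then have "root r (real (card {d. d dvd y}) ^ r) \<le> K" 
      unfolding K_def using r by (subst real_root_le_iff) auto
    then show ?thesis using r by (simp add: real_root_power_cancel)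
  qed
  have lnK: "ln K = (ln C + real j * X) / real r"
  proof -
    have "ln K = ln (C * real x ^ j) / real r" unfolding K_def using r Cx by (intro ln_root) auto
    also have "ln (C * real x ^ j) = ln C + real j * X"
      using C(1) x2 by (simp add: ln_mult ln_realpow X_def)
    finally show ?thesis .
  qed
  have xP: "x < P"
    using xlb power_increasing[of 1 j x] j x2 by simp
  have bounds: "\<bar>log_cycle_density (product_graph P x) i / X - ray j i\<bar> \<le> \<epsilon>" if i: "i \<in> {1..k}" for i
  proof -
    let ?L = "log_cycle_density (product_graph P x) i"
    have i1: "i \<ge> 1" and ik: "real i \<le> real k" using i by auto
    have lo: "?L \<ge> X * ray j i - 4 * real i * real j"
      and up: "?L \<le> X * ray j i + real i * ln K"
      unfolding X_def by (rule log_cycle_density_product_graph[OF P(1) j x2 xlb xub K1 Kd i1]; assumption)+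
    have "4 * real i * real j \<le> 4 * real k * real j" using ik by (intro mult_right_mono) auto
    also have "\<dots> \<le> \<epsilon> * X" using X(2) eps by (simp add: field_simps)
    finally have 1: "4 * real i * real j \<le> \<epsilon> * X" .
    have "real i * ln K \<le> real k * ln K" using ik K1 by (intro mult_right_mono) auto
    also have "\<dots> = real k * ln C / real r + (real k * real j / real r) * X"
      by (simp add: lnK add_divide_distrib algebra_simps)
    also have "\<dots> \<le> real k * ln C + \<epsilon> / 2 * X"
    proof (intro add_mono mult_right_mono r(2))
      have "real k * ln C \<ge> 0" using C(1) by simp
      then show "real k * ln C / real r \<le> real k * ln C"
        using r(1) by (simp add: divide_le_eq mult_le_cancel_left1)
    qed (use X in auto)
    also have "\<dots> \<le> \<epsilon> / 2 * X + \<epsilon> / 2 * X" using X(3) eps by (simp add: field_simps)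
    finally have 2: "real i * ln K \<le> \<epsilon> * X" by (simp add: mult.commute)
    have "?L / X - ray j i = (?L - X * ray j i) / X" using X(1) by (simp add: field_simps)
    moreover have "\<bar>?L - X * ray j i\<bar> \<le> \<epsilon> * X" using lo up 1 2 by (auto simp: abs_le_iff)
    ultimately show ?thesis using X(1) by (simp add: abs_divide divide_le_eq)
  qed
  have "edge_graph (product_graph P x)" by (rule edge_graph_product_graph[OF P(1) x2 xP])
  then show "\<exists>(T :: nat pair_pre_digraph) X. edge_graph T \<and> X > 0 \<and>
      (\<forall>i\<in>{1..k}. \<bar>log_cycle_density T i / X - ray j i\<bar> \<le> \<epsilon>)"
    using bounds X(1) by (intro exI[of _ "product_graph P x"] exI[of _ X]) auto
qed

text \<open>One edge and n - 2 isolated vertices: the homomorphism count lies between 1 and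
  \<open>2 ^ (2 * i)\<close>, so the density is about \<open>n ^ (2 * i)\<close> inverted, and X = 2
  * ln n makes the exponent -i.\<close>

lemma approximable_linear: "approximable k (\<lambda>i. - real i)"
  unfolding approximable_def
proof (intro allI impI)
  fix \<epsilon> :: real assume eps: "\<epsilon> > 0"
  obtain n0 :: nat where n0: "real n0 > exp (real k / \<epsilon>)" using reals_Archimedean2 by blast
  define n where "n = n0 + 2"
  define T :: "nat pair_pre_digraph" where "T = \<lparr> pverts = {..<n}, parcs = {(0, 1), (1, 0)} \<rparr>"
  have pg: "pair_graph T" by (auto simp: pair_graph_iff T_def n_def sym_def irrefl_def)
  then have eg: "edge_graph T" by (simp add: edge_graph_def T_def)
  have sm: "sym (parcs T)" by (auto simp: T_def sym_def)
  define X where "X = 2 * ln (real n)"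
  have "real n > exp (real k / \<epsilon>)" using n0 by (simp add: n_def)
  then have X: "X > 2 * (real k / \<epsilon>)"
    unfolding X_def by (smt (verit) exp_gt_zero exp_less_cancel_iff exp_ln)
  have X0: "X > 0" by (simp add: X_def n_def)
  have "\<bar>log_cycle_density T i / X - (- real i)\<bar> \<le> \<epsilon>" if i: "i \<in> {1..k}" for i
  proof -
    let ?H = "hom_set (cycle_graph (2 * i)) T"
    have i1: "i \<ge> 1" using i by simp
    have sub: "?H \<subseteq> {..<2 * i} \<rightarrow>\<^sub>E {0, 1}"
      unfolding hom_set_cycle_graph[OF sm] by (auto simp: T_def PiE_iff extensional_def)
    have fin: "finite ({..<2 * i} \<rightarrow>\<^sub>E {0::nat, 1})" by (intro finite_PiE) auto
    have "card ?H \<le> card ({..<2 * i} \<rightarrow>\<^sub>E {0::nat, 1})" using sub fin by (rule card_mono[rotated])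
    then have "real (card ?H) \<le> real (2 ^ (2 * i))" by (subst of_nat_le_iff) (simp add: card_PiE numeral_2_eq_2)
    then have Hu: "real (card ?H) \<le> 2 ^ (2 * i)" by simp
    \<comment> \<open>The parity colouring maps the cycle to the edge; wrapping around respects
      parity because the length is even.\<close>
    have "(l + 1) mod (2 * i) mod 2 = (l + 1) mod 2" for l by (simp add: mod_mod_cancel)
    then have "(\<lambda>l\<in>{..<2 * i}. l mod 2) \<in> ?H"
      unfolding hom_set_cycle_graph[OF sm] using i1
      by (auto simp: T_def n_def mod2_eq_if)
    then have Hl: "real (card ?H) \<ge> 1"
      using finite_subset[OF sub fin] by (metis One_nat_def Suc_leI card_gt_0_iff empty_iff of_nat_1 of_nat_le_iff)
    have "log_cycle_density T i = ln (real (card ?H) / real n ^ (2 * i))"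
      by (simp add: log_cycle_density_def hom_density_def cycle_graph_def T_def)
    also have "\<dots> = ln (real (card ?H)) - real i * X"
      using Hl by (simp add: ln_div ln_realpow X_def n_def)
    finally have eq: "log_cycle_density T i / X - (- real i) = ln (real (card ?H)) / X"
      using X0 by (simp add: field_simps)
    have "ln (real (card ?H)) \<le> ln (2 ^ (2 * i))" using Hu Hl by (subst ln_le_cancel_iff) auto
    also have "\<dots> = 2 * real i * ln 2" by (simp add: ln_realpow)
    also have "\<dots> \<le> 2 * real k * 1"
      using i ln_add_one_self_le_self[of 1] by (intro mult_mono) auto
    also have "\<dots> \<le> \<epsilon> * X" using X eps by (simp add: field_simps)
    finally show ?thesis unfolding eq using X0 Hl by (simp add: divide_le_eq)
  qed
  with eg X0 show "\<exists>(T :: nat pair_pre_digraph) X. edge_graph T \<and> X > 0 \<and>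
      (\<forall>i\<in>{1..k}. \<bar>log_cycle_density T i / X - (- real i)\<bar> \<le> \<epsilon>)" by blast
qed

section \<open>Tensor products and realizable directions\<close>

text \<open>Pairs are encoded as natural numbers, so that products keep the vertex type of the
  density profile and can be iterated.\<close>

definition tensor_graph ::
    "nat pair_pre_digraph \<Rightarrow> nat pair_pre_digraph \<Rightarrow> nat pair_pre_digraph" where
  "tensor_graph T T' =
     \<lparr> pverts = prod_encode ` (pverts T \<times> pverts T'),
       parcs = {(prod_encode (u, u'), prod_encode (v, v')) | u v u' v'.
          (u, v) \<in> parcs T \<and> (u', v') \<in> parcs T'} \<rparr>"

lemma parcs_tensor_graph_iff:
  "(prod_encode (u, u'), prod_encode (v, v')) \<in> parcs (tensor_graph T T') \<longleftrightarrow>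
     (u, v) \<in> parcs T \<and> (u', v') \<in> parcs T'"
  by (auto simp: tensor_graph_def)

lemma edge_graph_tensor_graph:
  assumes "edge_graph T" "edge_graph T'"
  shows "edge_graph (tensor_graph T T')"
proof -
  have "pair_graph (tensor_graph T T')"
    using assms unfolding edge_graph_def pair_graph_iff tensor_graph_def sym_def irrefl_def
    by (auto 0 3)
  moreover have "parcs (tensor_graph T T') \<noteq> {}"
    using assms unfolding edge_graph_def tensor_graph_def by fastforce
  ultimately show ?thesis by (simp add: edge_graph_def)
qed

lemma sum_pverts_tensor_graph:
  "(\<Sum>x\<in>pverts (tensor_graph T T'). f x) = (\<Sum>u\<in>pverts T. \<Sum>u'\<in>pverts T'. f (prod_encode (u, u')))"
proof -
  have "(\<Sum>x\<in>pverts (tensor_graph T T'). f x) = (\<Sum>p\<in>pverts T \<times> pverts T'. f (prod_encode p))"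
    unfolding tensor_graph_def by (simp add: sum.reindex inj_prod_encode o_def)
  then show ?thesis by (simp add: sum.cartesian_product case_prod_beta)
qed

lemma walks_tensor_graph:
  "walks (tensor_graph T T') l (prod_encode (u, u')) (prod_encode (v, v')) = walks T l u v * walks T' l u' v'"
proof (induction l arbitrary: v v')
  case (Suc l)
  have "walks (tensor_graph T T') (Suc l) (prod_encode (u, u')) (prod_encode (v, v')) =
      (\<Sum>x\<in>pverts T. \<Sum>x'\<in>pverts T'. (walks T l u x * of_bool ((x, v) \<in> parcs T)) *
         (walks T' l u' x' * of_bool ((x', v') \<in> parcs T')))"
    by (simp add: sum_pverts_tensor_graph Suc.IH parcs_tensor_graph_iff of_bool_conj mult_ac)
  then show ?case by (simp add: sum_product)
qed simp

lemma walk_moment_tensor_graph: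
  "walk_moment (tensor_graph T T') i = walk_moment T i * walk_moment T' i"
proof -
  have "walk_moment (tensor_graph T T') i =
      (\<Sum>u\<in>pverts T. \<Sum>u'\<in>pverts T'. (\<Sum>v\<in>pverts T. \<Sum>v'\<in>pverts T'.
         (walks T i u v)\<^sup>2 * (walks T' i u' v')\<^sup>2))"
    by (simp add: walk_moment_def sum_pverts_tensor_graph walks_tensor_graph power_mult_distrib)
  then show ?thesis by (simp add: walk_moment_def sum_product)
qed

lemma log_cycle_density_tensor_graph:
  assumes "edge_graph T" "edge_graph T'" "i \<ge> 1"
  shows "log_cycle_density (tensor_graph T T') i = log_cycle_density T i + log_cycle_density T' i"
proof -
  have "card (pverts (tensor_graph T T')) = card (pverts T) * card (pverts T')"
    by (simp add: tensor_graph_def card_image inj_prod_encode card_cartesian_product)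
  moreover have "walk_moment T i > 0" "walk_moment T' i > 0"
    using assms walk_moment_pos by (auto simp: edge_graph_def)
  ultimately show ?thesis
    using edge_graph_card_pos[OF assms(1)] edge_graph_card_pos[OF assms(2)] assms(3)
    by (simp add: log_cycle_density_eq edge_graph_tensor_graph assms(1,2) walk_moment_tensor_graph
        ln_mult algebra_simps)
qed

text \<open>Has m + 1 factors: the neutral element of the tensor product would be a looped vertex,
  which is not a simple graph.\<close>

primrec tensor_power :: "nat pair_pre_digraph \<Rightarrow> nat \<Rightarrow> nat pair_pre_digraph" where
  "tensor_power T 0 = T"
| "tensor_power T (Suc m) = tensor_graph T (tensor_power T m)"

lemma edge_graph_tensor_power: "edge_graph T \<Longrightarrow> edge_graph (tensor_power T m)"
  by (induction m) (auto intro: edge_graph_tensor_graph)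

lemma log_cycle_density_tensor_power:
  assumes "edge_graph T" "i \<ge> 1"
  shows "log_cycle_density (tensor_power T m) i = real (m + 1) * log_cycle_density T i"
  using assms
  by (induction m) (auto simp: log_cycle_density_tensor_graph edge_graph_tensor_power algebra_simps)

text \<open>The quotient is the logarithm to base \<open>1 / t\<close>, so y is the limit of points
  of the logarithmic images that come from actual graphs.\<close>

definition realizable :: "(nat \<Rightarrow> real) \<Rightarrow> bool" where
  "realizable y \<longleftrightarrow> (\<exists>F :: real \<Rightarrow> nat pair_pre_digraph. (\<forall>t. edge_graph (F t)) \<and>
     (\<forall>i\<ge>1. ((\<lambda>t. log_cycle_density (F t) i / ln (1 / t)) \<longlongrightarrow> y i) (at_right 0)))"

lemma realizable_add:
  assumes "realizable y" "realizable y'"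
  shows "realizable (\<lambda>i. y i + y' i)"
proof -
  obtain F F' :: "real \<Rightarrow> nat pair_pre_digraph"
    where F: "\<And>t. edge_graph (F t)" "\<And>t. edge_graph (F' t)"
    and lim: "\<And>i. i \<ge> 1 \<Longrightarrow> ((\<lambda>t. log_cycle_density (F t) i / ln (1 / t)) \<longlongrightarrow> y i) (at_right 0)"
      "\<And>i. i \<ge> 1 \<Longrightarrow> ((\<lambda>t. log_cycle_density (F' t) i / ln (1 / t)) \<longlongrightarrow> y' i) (at_right 0)"
    using assms unfolding realizable_def by blast
  show ?thesis
    unfolding realizable_def
  proof (intro exI[of _ "\<lambda>t. tensor_graph (F t) (F' t)"] conjI allI impI)
    fix i :: nat assume "1 \<le> i"
    then show "((\<lambda>t. log_cycle_density (tensor_graph (F t) (F' t)) i / ln (1 / t)) \<longlongrightarrow> y i + y' i) (at_right 0)"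
      using tendsto_add[OF lim(1) lim(2), of i i] F
      by (simp add: log_cycle_density_tensor_graph add_divide_distrib)
  qed (use F edge_graph_tensor_graph in blast)
qed

lemma floor_ratio_tendsto:
  assumes "c \<ge> 0"
  shows "((\<lambda>L::real. real (nat \<lfloor>c * L\<rfloor> + 1) / L) \<longlongrightarrow> c) at_top"
proof (rule tendsto_sandwich)
  have ev: "\<forall>\<^sub>F L::real in at_top. L > 0" by (rule eventually_gt_at_top)
  show "\<forall>\<^sub>F L in at_top. c \<le> real (nat \<lfloor>c * L\<rfloor> + 1) / L"
    using ev
  proof eventually_elim
    case (elim L)
    have "c * L \<le> real (nat \<lfloor>c * L\<rfloor> + 1)" using assms elim by linarith
    then show ?case using elim by (simp add: field_simps)
  qed
  show "\<forall>\<^sub>F L in at_top. real (nat \<lfloor>c * L\<rfloor> + 1) / L \<le> c + 1 / L"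
    using ev
  proof eventually_elim
    case (elim L)
    have "c * L \<ge> 0" using assms elim by simp
    then have "real (nat \<lfloor>c * L\<rfloor> + 1) \<le> c * L + 1" by linarith
    then show ?case using elim by (simp add: field_simps)
  qed
  show "((\<lambda>L::real. c + 1 / L) \<longlongrightarrow> c) at_top" by real_asymp
qed simp

text \<open>Tensor powers with about c * ln (1 / t) factors multiply the logarithms by that number.
  For c = 0 the one remaining factor vanishes in the limit.\<close>

lemma realizable_scale:
  fixes T :: "nat pair_pre_digraph"
  assumes "edge_graph T" "c \<ge> 0"
  shows "realizable (\<lambda>i. c * log_cycle_density T i)"
  unfolding realizable_def
proof (intro exI[of _ "\<lambda>t. tensor_power T (nat \<lfloor>c * ln (1 / t)\<rfloor>)"] conjI allI impI)
  fix i :: nat assume i: "1 \<le> i"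
  have "filterlim (\<lambda>t::real. ln (1 / t)) at_top (at_right 0)" by real_asymp
  from filterlim_compose[OF floor_ratio_tendsto[OF assms(2)] this]
  have "((\<lambda>t. real (nat \<lfloor>c * ln (1 / t)\<rfloor> + 1) / ln (1 / t) * log_cycle_density T i)
      \<longlongrightarrow> c * log_cycle_density T i) (at_right 0)"
    by (rule tendsto_mult_right)
  then show "((\<lambda>t. log_cycle_density (tensor_power T (nat \<lfloor>c * ln (1 / t)\<rfloor>)) i / ln (1 / t))
      \<longlongrightarrow> c * log_cycle_density T i) (at_right 0)"
    by (simp only: log_cycle_density_tensor_power[OF assms(1) i] times_divide_eq_left)
qed (rule edge_graph_tensor_power[OF assms(1)])

text \<open>Adds limits, since the rays are only approximated by graphs.\<close>

definition limit_realizable :: "nat \<Rightarrow> (nat \<Rightarrow> real) \<Rightarrow> bool" where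
  "limit_realizable k z \<longleftrightarrow> (\<exists>w. (\<forall>m::nat. realizable (w m)) \<and>
     (\<forall>i\<in>{1..k}. (\<lambda>m. w m i) \<longlonglongrightarrow> z i))"

lemma limit_realizable_add:
  assumes "limit_realizable k z" "limit_realizable k z'"
  shows "limit_realizable k (\<lambda>i. z i + z' i)"
proof -
  obtain w w' where "\<And>m. realizable (w m)" "\<And>m. realizable (w' m)"
    "\<And>i. i \<in> {1..k} \<Longrightarrow> (\<lambda>m. w m i) \<longlonglongrightarrow> z i" "\<And>i. i \<in> {1..k} \<Longrightarrow> (\<lambda>m. w' m i) \<longlonglongrightarrow> z' i"
    using assms unfolding limit_realizable_def by blast
  then show ?thesis
    unfolding limit_realizable_def
    by (intro exI[of _ "\<lambda>m i. w m i + w' m i"]) (auto intro!: realizable_add tendsto_add)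
qed

lemma limit_realizable_approximable:
  assumes "approximable k r" "c \<ge> 0"
  shows "limit_realizable k (\<lambda>i. c * r i)"
proof -
  have "\<exists>T X. edge_graph T \<and> X > 0 \<and>
      (\<forall>i\<in>{1..k}. \<bar>log_cycle_density (T :: nat pair_pre_digraph) i / X - r i\<bar> \<le> 1 / real (Suc m))" for m
    using assms(1) unfolding approximable_def by simp
  then obtain T X where T: "\<And>m. edge_graph (T m :: nat pair_pre_digraph)" and X: "\<And>m. X m > 0"
    and b: "\<And>m i. i \<in> {1..k} \<Longrightarrow> \<bar>log_cycle_density (T m) i / X m - r i\<bar> \<le> 1 / real (Suc m)"
    by metis
  have "realizable (\<lambda>i. c / X m * log_cycle_density (T m) i)" for m
    using T X[of m] assms(2) by (intro realizable_scale) auto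
  moreover have "(\<lambda>m. c / X m * log_cycle_density (T m) i) \<longlonglongrightarrow> c * r i" if "i \<in> {1..k}" for i
  proof -
    have "(\<lambda>m. log_cycle_density (T m) i / X m - r i) \<longlonglongrightarrow> 0"
    proof (rule Lim_null_comparison)
      show "\<forall>\<^sub>F m in sequentially. norm (log_cycle_density (T m) i / X m - r i) \<le> 1 / real (Suc m)"
        using b[OF that] by (auto intro: always_eventually)
      show "(\<lambda>m. 1 / real (Suc m)) \<longlonglongrightarrow> 0"
        using LIMSEQ_inverse_real_of_nat by (simp add: inverse_eq_divide)
    qed
    then have "(\<lambda>m. log_cycle_density (T m) i / X m) \<longlonglongrightarrow> r i" by (simp add: LIM_zero_iff)
    from tendsto_mult_left[OF this, of c] show ?thesis by simp
  qed
  ultimately show ?thesis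
    unfolding limit_realizable_def by (intro exI[of _ "\<lambda>m i. c / X m * log_cycle_density (T m) i"]) auto
qed

lemma limit_realizable_sum:
  assumes "finite J" "limit_realizable k z" "\<And>j. j \<in> J \<Longrightarrow> limit_realizable k (f j)"
  shows "limit_realizable k (\<lambda>i. z i + (\<Sum>j\<in>J. f j i))"
  using assms(1,3)
proof (induction J rule: finite_induct)
  case (insert j J)
  have "limit_realizable k (\<lambda>i. f j i + (z i + (\<Sum>j\<in>J. f j i)))"
    using insert by (intro limit_realizable_add[of k "f j"]) auto
  then show ?case using insert by (simp add: add_ac)
qed (use assms(2) in simp)

section \<open>Rays and facets of the cone\<close>

lemma ray_second_difference:
  assumes "m \<ge> 1"
  shows "ray j (m - 1) - 2 * ray j m + ray j (m + 1) = of_bool (j = m)"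
proof -
  obtain n where m: "m = Suc n" using assms by (cases m) auto
  \<comment> \<open>The maximum makes \<open>ray j\<close> affine on either side of j, with its only
    kink at j.\<close>
  consider "j \<le> n" | "j = Suc n" | "j \<ge> Suc (Suc n)" by linarith
  then show ?thesis by cases (auto simp: m ray_def max_def algebra_simps)
qed

text \<open>The cone is simplicial: its facets are indexed like its rays, and the defect of \<open>z\<close> at a
  facet is the coefficient of the opposite ray.\<close>

lemma ray_decomposition:
  fixes z :: "nat \<Rightarrow> real"
  assumes k: "k \<ge> 2" and i: "i \<in> {1..k}"
  defines "\<beta> \<equiv> \<lambda>j. if j = k then (real k * z (k - 1) - (real k - 1) * z k) / real k
      else z (j - 1) - 2 * z j + z (j + 1)"
    and "\<alpha> \<equiv> (z k - 2 * real k * z 1) / real k"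
  shows "z i = \<alpha> * (- real i) + (\<Sum>j\<in>{2..k}. \<beta> j * ray j i)"
proof -
  \<comment> \<open>w is the claimed combination and d its error; the equations below, one for each
    facet, force d to vanish on \<open>{1..k}\<close>.\<close>
  define w where "w i = \<alpha> * (- real i) + (\<Sum>j\<in>{2..k}. \<beta> j * ray j i)" for i
  define d where "d i = z i - w i" for i
  have comb: "a * w p + b * w q + c * w r =
      \<alpha> * (- (a * real p + b * real q + c * real r)) +
      (\<Sum>j\<in>{2..k}. \<beta> j * (a * ray j p + b * ray j q + c * ray j r))" for a b c p q r
    by (simp add: w_def algebra_simps sum.distrib sum_distrib_left)
  have second: "d (m - 1) - 2 * d m + d (m + 1) = 0" if m: "2 \<le> m" "m < k" for m
  proof -
    have "w (m - 1) - 2 * w m + w (m + 1) = 1 * w (m - 1) + (- 2) * w m + 1 * w (m + 1)" by simp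
    also have "\<dots> = (\<Sum>j\<in>{2..k}. \<beta> j * (ray j (m - 1) - 2 * ray j m + ray j (m + 1)))"
      unfolding comb using m by (simp add: of_nat_diff)
    also have "\<dots> = (\<Sum>j\<in>{2..k}. if j = m then \<beta> j else 0)"
      using m by (intro sum.cong refl, subst ray_second_difference) auto
    also have "\<dots> = z (m - 1) - 2 * z m + z (m + 1)" using m by (simp add: \<beta>_def)
    finally show ?thesis by (simp add: d_def)
  qed
  have norm: "real k * d (k - 1) - (real k - 1) * d k = 0"
  proof -
    have "real k * w (k - 1) - (real k - 1) * w k = real k * w (k - 1) + (- (real k - 1)) * w k + 0 * w 0"
      by (simp add: algebra_simps)
    also have "\<dots> = (\<Sum>j\<in>{2..k}. \<beta> j * (real k * ray j (k - 1) - (real k - 1) * ray j k))"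
      unfolding comb using k by (simp add: of_nat_diff algebra_simps)
    also have "\<dots> = (\<Sum>j\<in>{2..k}. if j = k then \<beta> j * real k else 0)"
    proof (intro sum.cong refl)
      fix j assume j: "j \<in> {2..k}"
      show "\<beta> j * (real k * ray j (k - 1) - (real k - 1) * ray j k) = (if j = k then \<beta> j * real k else 0)"
      proof (cases "j = k")
        case True
        then show ?thesis using k by (simp add: ray_def of_nat_diff algebra_simps)
      next
        case False
        \<comment> \<open>For j < k, both k - 1 and k lie on the branch where \<open>ray j\<close>
          is proportional to the index, so the functional vanishes.\<close>
        then have "real j \<le> real k - 1" using j by (auto simp: of_nat_diff)
        then have "max (real k - 1) (real j) = real k - 1" "max (real k) (real j) = real k" by auto
        then show ?thesis using k False by (simp add: ray_def of_nat_diff algebra_simps)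
      qed
    qed
    also have "\<dots> = real k * z (k - 1) - (real k - 1) * z k" using k by (simp add: \<beta>_def)
    finally show ?thesis by (simp add: d_def algebra_simps)
  qed
  \<comment> \<open>Each \<open>ray j\<close> attains equality in Sidorenko's inequality, so only
    the linear ray contributes.\<close>
  have sid: "d k - 2 * real k * d 1 = 0"
  proof -
    have "w k - 2 * real k * w 1 = 1 * w k + (- 2 * real k) * w 1 + 0 * w 0" by simp
    also have "\<dots> = \<alpha> * real k + (\<Sum>j\<in>{2..k}. \<beta> j * (ray j k - 2 * real k * ray j 1))"
      unfolding comb by simp
    also have "(\<Sum>j\<in>{2..k}. \<beta> j * (ray j k - 2 * real k * ray j 1)) = 0"
      by (intro sum.neutral ballI) (auto simp: ray_def max_def algebra_simps)
    also have "\<alpha> * real k + 0 = z k - 2 * real k * z 1" using k by (simp add: \<alpha>_def)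
    finally show ?thesis by (simp add: d_def algebra_simps)
  qed
  have lin: "d (Suc m) = d 1 + real m * (d 2 - d 1)" if "Suc m \<le> k" for m
    using that
  proof (induction m rule: less_induct)
    case (less m)
    consider "m = 0" | "m = 1" | n where "m = Suc (Suc n)" by (metis One_nat_def nat.exhaust)
    then show ?case
    proof cases
      case (3 n)
      have "d (Suc n) - 2 * d (Suc (Suc n)) + d (Suc (Suc (Suc n))) = 0"
        using second[of "Suc (Suc n)"] less.prems 3 by simp
      moreover have "d (Suc n) = d 1 + real n * (d 2 - d 1)"
        "d (Suc (Suc n)) = d 1 + real (Suc n) * (d 2 - d 1)"
        using less.IH[of n] less.IH[of "Suc n"] less.prems 3 by auto
      ultimately show ?thesis using 3 by (simp add: algebra_simps)
    qed (auto simp: numeral_2_eq_2)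
  qed
  obtain n where n: "k = Suc (Suc n)" using k by (metis add_2_eq_Suc le_Suc_ex)
  have dk: "d k = d 1 + real (Suc n) * (d 2 - d 1)" "d (k - 1) = d 1 + real n * (d 2 - d 1)"
    using lin[of "Suc n"] lin[of n] n by auto
  \<comment> \<open>d is affine by its second differences; the norm equation makes it proportional
    to the index, and then d k = 2 * k * d 1 forces d 1 = 0.\<close>
  have "d 2 = 2 * d 1" using norm unfolding dk by (simp add: n algebra_simps)
  with dk sid have "real k * d 1 = 0" by (simp add: n algebra_simps)
  then have "d 1 = 0" using k by simp
  with \<open>d 2 = 2 * d 1\<close> lin[of "i - 1"] i have "d i = 0" by auto
  then show ?thesis by (simp add: d_def w_def)
qed

section \<open>The tropicalization\<close>

lemma length_even_cycles: "length (even_cycles k) = k"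
  by (simp add: even_cycles_def)

lemma density_vector_even_cycles:
  "density_vector (even_cycles k) T i = (if i < k then hom_density (cycle_graph (2 * (i + 1))) T else 0)"
  by (auto simp: density_vector_def even_cycles_def simp del: upt_Suc)

lemma density_vector_in_Euclidean_space:
  "density_vector (even_cycles k) T \<in> topspace (Euclidean_space k)"
  by (simp add: topspace_Euclidean_space density_vector_even_cycles)

lemma limitin_Euclidean_space_iff:
  assumes "\<And>t. g t \<in> topspace (Euclidean_space k)"
  shows "limitin (Euclidean_space k) g y F \<longleftrightarrow>
    y \<in> topspace (Euclidean_space k) \<and> (\<forall>i<k. ((\<lambda>t. g t i) \<longlongrightarrow> y i) F)" (is "?L \<longleftrightarrow> ?R")
proof -
  have "?L \<longleftrightarrow> y \<in> topspace (Euclidean_space k) \<and> (\<forall>i. ((\<lambda>t. g t i) \<longlongrightarrow> y i) F)"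
    using assms unfolding Euclidean_space_def
    by (simp add: limitin_subtopology limitin_componentwise)
  also have "\<dots> \<longleftrightarrow> ?R"
  proof -
    have "((\<lambda>t. g t i) \<longlongrightarrow> y i) F" if "y \<in> topspace (Euclidean_space k)" "i \<ge> k" for i
      using assms that by (simp add: topspace_Euclidean_space)
    then show ?thesis by (meson not_le)
  qed
  finally show ?thesis .
qed

text \<open>The logarithms of the density vectors of the realizing graphs lie in the images and
  converge to y. Coordinate i belongs to the cycle of length 2(i + 1), whence the shift.\<close>

lemma log_image_meets_open:
  assumes "realizable y" "openin (Euclidean_space k) U" "(\<lambda>i. if i < k then y (i + 1) else 0) \<in> U"
  shows "\<forall>\<^sub>F t in at_right 0. log_image k (1 / t) (density_profile (even_cycles k)) \<inter> U \<noteq> {}"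
proof -
  obtain F :: "real \<Rightarrow> nat pair_pre_digraph" where F: "\<And>t. edge_graph (F t)"
    and lim: "\<And>i. i \<ge> 1 \<Longrightarrow> ((\<lambda>t. log_cycle_density (F t) i / ln (1 / t)) \<longlongrightarrow> y i) (at_right 0)"
    using assms(1) unfolding realizable_def by blast
  define g where "g t i = (if i < k then log (1 / t) (density_vector (even_cycles k) (F t) i) else 0)" for t i
  have g: "g t \<in> log_image k (1 / t) (density_profile (even_cycles k))" for t
    unfolding log_image_def
  proof (rule image_eqI[of _ _ "density_vector (even_cycles k) (F t)"])
    show "g t = (\<lambda>i. if i < k then log (1 / t) (density_vector (even_cycles k) (F t) i) else 0)"
      by (simp add: g_def fun_eq_iff)
    let ?S = "{density_vector (even_cycles k) T | T :: nat pair_pre_digraph. pair_graph T \<and> pverts T \<noteq> {}}"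
    have "?S \<subseteq> Euclidean_space k closure_of ?S"
      by (intro closure_of_subset) (auto simp: density_vector_in_Euclidean_space)
    moreover have "pair_graph (F t)" "pverts (F t) \<noteq> {}"
      using F[of t] edge_graph_card_pos[OF F[of t]] by (auto simp: edge_graph_def)
    ultimately have "density_vector (even_cycles k) (F t) \<in> density_profile (even_cycles k)"
      unfolding density_profile_def length_even_cycles by blast
    then show "density_vector (even_cycles k) (F t) \<in>
        {v \<in> density_profile (even_cycles k). \<forall>i<k. 0 < v i}"
      using hom_density_even_cycle_pos[OF F[of t]] by (simp add: density_vector_even_cycles del: mult_Suc_right)
  qed
  have "limitin (Euclidean_space k) g (\<lambda>i. if i < k then y (i + 1) else 0) (at_right 0)"
  proof (subst limitin_Euclidean_space_iff)
    have "((\<lambda>t. g t i) \<longlongrightarrow> y (i + 1)) (at_right 0)" if "i < k" for i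
      using lim[of "i + 1"] that
      by (simp add: g_def density_vector_even_cycles log_def log_cycle_density_def del: mult_Suc_right)
    then show "(\<lambda>i. if i < k then y (i + 1) else 0) \<in> topspace (Euclidean_space k) \<and>
        (\<forall>i<k. ((\<lambda>t. g t i) \<longlongrightarrow> (if i < k then y (i + 1) else 0)) (at_right 0))"
      by (simp add: topspace_Euclidean_space)
  qed (simp add: g_def topspace_Euclidean_space)
  then have "\<forall>\<^sub>F t in at_right 0. g t \<in> U" using assms(2,3) by (simp add: limitin_def)
  then show ?thesis by eventually_elim (use g in blast)
qed

text \<open>Lower limits are closed: some realizable \<open>w m\<close> already lies in the given
  neighbourhood.\<close>

lemma limit_realizable_in_lower_limit:
  assumes "limit_realizable k z"
  shows "(\<lambda>i. if i < k then z (i + 1) else 0) \<in> lower_limit (Euclidean_space k)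
    (\<lambda>t. log_image k (1 / t) (density_profile (even_cycles k))) (at_right 0)"
  unfolding lower_limit_def
proof (intro CollectI conjI allI impI)
  let ?y = "\<lambda>z i. if i < k then z (i + 1) else (0::real)"
  show "?y z \<in> topspace (Euclidean_space k)" by (simp add: topspace_Euclidean_space)
  fix U assume U: "openin (Euclidean_space k) U \<and> ?y z \<in> U"
  obtain w where w: "\<And>m::nat. realizable (w m)" "\<And>i. i \<in> {1..k} \<Longrightarrow> (\<lambda>m. w m i) \<longlonglongrightarrow> z i"
    using assms unfolding limit_realizable_def by blast
  have "limitin (Euclidean_space k) (\<lambda>m. ?y (w m)) (?y z) sequentially"
    using w(2) by (subst limitin_Euclidean_space_iff) (auto simp: topspace_Euclidean_space)
  then have "\<forall>\<^sub>F m in sequentially. ?y (w m) \<in> U" using U by (simp add: limitin_def)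
  from eventually_happens'[OF sequentially_bot this] obtain m where "?y (w m) \<in> U" ..
  then show "\<forall>\<^sub>F t in at_right 0. log_image k (1 / t) (density_profile (even_cycles k)) \<inter> U \<noteq> {}"
    using log_image_meets_open[OF w(1)[of m]] U by simp
qed

text \<open>The inequalities of the cone say that all coefficients of the ray decomposition are
  nonnegative.\<close>

lemma Q_cone_limit_realizable:
  assumes k: "k \<ge> 2" and y: "y \<in> Q_cone k"
  shows "limit_realizable k (\<lambda>i. y (i - 1))"
proof -
  define z where "z i = y (i - 1)" for i
  define \<beta> where "\<beta> j = (if j = k then (real k * z (k - 1) - (real k - 1) * z k) / real k
      else z (j - 1) - 2 * z j + z (j + 1))" for j
  define \<alpha> where "\<alpha> = (z k - 2 * real k * z 1) / real k"
  have Q: "\<And>i. 1 \<le> i \<Longrightarrow> i \<le> k - 2 \<Longrightarrow> y (i - 1) - 2 * y i + y (i + 1) \<ge> 0"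
    "2 * real k * y (k - 2) - (2 * real k - 2) * y (k - 1) \<ge> 0"
    "- 2 * real k * y 0 + y (k - 1) \<ge> 0"
    using y by (auto simp: Q_cone_def)
  have \<alpha>: "\<alpha> \<ge> 0" using Q(3) k by (simp add: \<alpha>_def z_def)
  have \<beta>: "\<beta> j \<ge> 0" if "j \<in> {2..k}" for j
  proof (cases "j = k")
    case True
    have "real k * y (k - 2) - (real k - 1) * y (k - 1) \<ge> 0" using Q(2) by (simp add: algebra_simps)
    then show ?thesis using True k by (simp add: \<beta>_def z_def numeral_2_eq_2)
  next
    case False
    then have "1 \<le> j - 1" "j - 1 \<le> k - 2" using that by auto
    from Q(1)[OF this] show ?thesis using False that by (simp add: \<beta>_def z_def)
  qed
  have "limit_realizable k (\<lambda>i. \<alpha> * (- real i) + (\<Sum>j\<in>{2..k}. \<beta> j * ray j i))"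
    using \<alpha> \<beta>
    by (intro limit_realizable_sum limit_realizable_approximable approximable_linear approximable_ray) auto
  moreover have "\<alpha> * (- real i) + (\<Sum>j\<in>{2..k}. \<beta> j * ray j i) = z i" if "i \<in> {1..k}" for i
    using ray_decomposition[OF k that, of z] by (simp add: \<alpha>_def \<beta>_def)
  ultimately have "limit_realizable k z" unfolding limit_realizable_def by simp
  then show ?thesis by (simp add: z_def[abs_def])
qed

lemma Q_cone_subset_lower_limit:
  assumes "k \<ge> 2"
  shows "Q_cone k \<subseteq> lower_limit (Euclidean_space k)
    (\<lambda>t. log_image k (1 / t) (density_profile (even_cycles k))) (at_right 0)"
proof
  fix y assume y: "y \<in> Q_cone k"
  then have "(\<lambda>i. if i < k then y (i + 1 - 1) else 0) = y"
    by (auto simp: Q_cone_def topspace_Euclidean_space fun_eq_iff)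
  then show "y \<in> lower_limit (Euclidean_space k)
      (\<lambda>t. log_image k (1 / t) (density_profile (even_cycles k))) (at_right 0)"
    using limit_realizable_in_lower_limit[OF Q_cone_limit_realizable[OF assms y]] by simp
qed

section \<open>Bounding the upper limit by the cone\<close>

lemma closedin_Euclidean_space_Int_closed:
  assumes "closed S"
  shows "closedin (Euclidean_space k) (topspace (Euclidean_space k) \<inter> S)"
proof -
  have "closed (topspace (Euclidean_space k))" using closedin_Euclidean_imp_closed by blast
  then show ?thesis using assms by (auto simp: closedin_Euclidean_space_iff)
qed

lemma closedin_Q_cone: "closedin (Euclidean_space k) (Q_cone k)"
proof -
  have "Q_cone k = topspace (Euclidean_space k) \<inter>
      ({y. \<forall>i. 1 \<le> i \<and> i \<le> k - 2 \<longrightarrow> 0 \<le> y (i - 1) - 2 * y i + y (i + 1)} \<inter>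
      {y. 0 \<le> 2 * real k * y (k - 2) - (2 * real k - 2) * y (k - 1)} \<inter>
      {y. 0 \<le> - 2 * real k * y 0 + y (k - 1)})"
    unfolding Q_cone_def by blast
  also have "closedin (Euclidean_space k) \<dots>"
    by (intro closedin_Euclidean_space_Int_closed closed_Int closed_Collect_all closed_Collect_imp
        closed_Collect_le open_Collect_const continuous_intros continuous_on_product_coordinates)
  finally show ?thesis .
qed

text \<open>The inequalities of \<open>Q_cone\<close> before taking logarithms; in this form they survive the
  closure in the definition of the density profile.\<close>

definition cycle_inequalities :: "nat \<Rightarrow> (nat \<Rightarrow> real) set" where
  "cycle_inequalities k =
     {v \<in> topspace (Euclidean_space k).
        (\<forall>i. 1 \<le> i \<and> i \<le> k - 2 \<longrightarrow> (v i)\<^sup>2 \<le> v (i - 1) * v (i + 1)) \<and>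
        v (k - 1) ^ (k - 1) \<le> v (k - 2) ^ k \<and>
        v 0 ^ (2 * k) \<le> v (k - 1)}"

lemma closedin_cycle_inequalities: "closedin (Euclidean_space k) (cycle_inequalities k)"
proof -
  have "cycle_inequalities k = topspace (Euclidean_space k) \<inter>
      ({v. \<forall>i. 1 \<le> i \<and> i \<le> k - 2 \<longrightarrow> (v i)\<^sup>2 \<le> v (i - 1) * v (i + 1)} \<inter>
      {v. v (k - 1) ^ (k - 1) \<le> v (k - 2) ^ k} \<inter> {v. v 0 ^ (2 * k) \<le> v (k - 1)})"
    unfolding cycle_inequalities_def by blast
  also have "closedin (Euclidean_space k) \<dots>"
    by (intro closedin_Euclidean_space_Int_closed closed_Int closed_Collect_all closed_Collect_imp
        closed_Collect_le open_Collect_const continuous_intros continuous_on_product_coordinates)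
  finally show ?thesis .
qed

lemma density_vector_cycle_inequalities:
  assumes "k \<ge> 2" "pair_graph T"
  shows "density_vector (even_cycles k) T \<in> cycle_inequalities k"
proof -
  define M where "M i = hom_density (cycle_graph (2 * i)) T" for i
  have v: "density_vector (even_cycles k) T i = M (i + 1)" if "i < k" for i
    using that unfolding density_vector_even_cycles M_def by simp
  have main: "(\<forall>i. 1 \<le> i \<and> i \<le> k - 2 \<longrightarrow> (M (i + 1))\<^sup>2 \<le> M i * M (i + 2)) \<and>
      M k ^ (k - 1) \<le> M (k - 1) ^ k \<and> M 1 ^ (2 * k) \<le> M k"
  proof (cases "parcs T = {}")
    \<comment> \<open>Without edges all densities are 0, and the inequalities hold because the
      exponents are positive.\<close>
    case True
    have "M i = 0" if "i \<ge> 1" for i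
    proof -
      have "hom_set (cycle_graph (2 * i)) T = {}"
        using hom_set_cycle_graph[of T "2 * i"] True that by (auto simp: sym_def intro!: exI[of _ 0])
      then show ?thesis by (simp add: M_def hom_density_def)
    qed
    then show ?thesis using assms(1) by (simp add: power_0_left)
  next
    case False
    then have eg: "edge_graph T" using assms(2) by (simp add: edge_graph_def)
    have pos: "M i > 0" if "i \<ge> 1" for i using hom_density_even_cycle_pos[OF eg that] by (simp add: M_def)
    have L: "log_cycle_density T i = ln (M i)" for i by (simp add: M_def log_cycle_density_def)
    have "(M (i + 1))\<^sup>2 \<le> M i * M (i + 2)" if "1 \<le> i" for i
    proof -
      have p: "M i > 0" "M (i + 1) > 0" "M (i + 2) > 0" using pos that by auto
      have "ln ((M (i + 1))\<^sup>2) \<le> ln (M i * M (i + 2))"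
        using log_cycle_density_convex[OF eg that] p unfolding L by (simp add: ln_realpow ln_mult)
      then show ?thesis using p by (subst (asm) ln_le_cancel_iff) auto
    qed
    moreover have "M k ^ (k - 1) \<le> M (k - 1) ^ k"
    proof -
      have p: "M k > 0" "M (k - 1) > 0" using pos assms(1) by auto
      have "ln (M k ^ (k - 1)) \<le> ln (M (k - 1) ^ k)"
        using log_cycle_density_norm_antimono[OF eg, of "k - 1" k] p assms(1)
        unfolding L by (simp add: ln_realpow)
      then show ?thesis using p by (subst (asm) ln_le_cancel_iff) auto
    qed
    moreover have "M 1 ^ (2 * k) \<le> M k"
    proof -
      have p: "M k > 0" "M 1 > 0" using pos assms(1) by auto
      have "ln (M 1 ^ (2 * k)) \<le> ln (M k)"
        using log_cycle_density_sidorenko[OF eg, of k] p assms(1) unfolding L by (simp add: ln_realpow)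
      then show ?thesis using p by (subst (asm) ln_le_cancel_iff) auto
    qed
    ultimately show ?thesis by blast
  qed
  have "(density_vector (even_cycles k) T i)\<^sup>2 \<le>
      density_vector (even_cycles k) T (i - 1) * density_vector (even_cycles k) T (i + 1)"
    if "1 \<le> i" "i \<le> k - 2" for i
    using main that assms(1) by (subst (1 2 3) v) auto
  moreover have "k - 2 + 1 = k - 1" using assms(1) by simp
  ultimately show ?thesis
    unfolding cycle_inequalities_def using main assms(1) v[of "k - 1"] v[of "k - 2"] v[of 0]
    by (simp add: density_vector_in_Euclidean_space)
qed

lemma density_profile_subset_cycle_inequalities:
  assumes "k \<ge> 2"
  shows "density_profile (even_cycles k) \<subseteq> cycle_inequalities k"
  unfolding density_profile_def length_even_cycles
  using density_vector_cycle_inequalities[OF assms]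
  by (intro closure_of_minimal closedin_cycle_inequalities) auto

text \<open>Points of the profile may be mere limits of density vectors, so logarithms are taken of
  the closed inequalities; b > 1 makes \<open>log b\<close> increasing.\<close>

lemma log_image_subset_Q_cone:
  assumes k: "k \<ge> 2" and b: "b > 1"
  shows "log_image k b (density_profile (even_cycles k)) \<subseteq> Q_cone k"
proof
  fix y assume "y \<in> log_image k b (density_profile (even_cycles k))"
  then obtain v where v: "v \<in> cycle_inequalities k" and pos: "\<And>i. i < k \<Longrightarrow> v i > 0"
    and y: "y = (\<lambda>i. if i < k then log b (v i) else 0)"
    using density_profile_subset_cycle_inequalities[OF k] unfolding log_image_def by auto
  have I: "\<And>i. 1 \<le> i \<Longrightarrow> i \<le> k - 2 \<Longrightarrow> (v i)\<^sup>2 \<le> v (i - 1) * v (i + 1)"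
    "v (k - 1) ^ (k - 1) \<le> v (k - 2) ^ k" "v 0 ^ (2 * k) \<le> v (k - 1)"
    using v by (auto simp: cycle_inequalities_def)
  have "y (i - 1) - 2 * y i + y (i + 1) \<ge> 0" if i: "1 \<le> i" "i \<le> k - 2" for i
  proof -
    have lt: "i - 1 < k" "i < k" "i + 1 < k" using i k by auto
    have p: "v (i - 1) > 0" "v i > 0" "v (i + 1) > 0" using pos lt by auto
    have "log b ((v i)\<^sup>2) \<le> log b (v (i - 1) * v (i + 1))"
      using I(1)[OF i] b p by (subst log_le_cancel_iff) auto
    then show ?thesis using lt p b by (simp add: y log_mult log_nat_power)
  qed
  moreover have "2 * real k * y (k - 2) - (2 * real k - 2) * y (k - 1) \<ge> 0"
  proof -
    have lt: "k - 1 < k" "k - 2 < k" using k by auto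
    have p: "v (k - 1) > 0" "v (k - 2) > 0" using pos lt by auto
    have "log b (v (k - 1) ^ (k - 1)) \<le> log b (v (k - 2) ^ k)"
      using I(2) b p by (subst log_le_cancel_iff) auto
    then show ?thesis using lt p b k by (simp add: y log_nat_power of_nat_diff algebra_simps)
  qed
  moreover have "- 2 * real k * y 0 + y (k - 1) \<ge> 0"
  proof -
    have lt: "k - 1 < k" "0 < k" using k by auto
    have p: "v (k - 1) > 0" "v 0 > 0" using pos lt by auto
    have "log b (v 0 ^ (2 * k)) \<le> log b (v (k - 1))"
      using I(3) b p by (subst log_le_cancel_iff) auto
    then show ?thesis using lt p b k by (simp add: y log_nat_power)
  qed
  ultimately show "y \<in> Q_cone k" by (simp add: Q_cone_def y topspace_Euclidean_space)
qed

text \<open>The complement of the closed cone is a neighbourhood of any point outside it, and no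
  image with 0 < t < 1 meets it.\<close>

lemma upper_limit_subset_Q_cone:
  assumes "k \<ge> 2"
  shows "upper_limit (Euclidean_space k)
    (\<lambda>t. log_image k (1 / t) (density_profile (even_cycles k))) (at_right 0) \<subseteq> Q_cone k"
proof (rule subsetI, rule ccontr)
  fix y assume y: "y \<in> upper_limit (Euclidean_space k)
      (\<lambda>t. log_image k (1 / t) (density_profile (even_cycles k))) (at_right 0)" and nQ: "y \<notin> Q_cone k"
  let ?U = "topspace (Euclidean_space k) - Q_cone k"
  have "openin (Euclidean_space k) ?U" using closedin_Q_cone by (simp add: closedin_def)
  moreover have "y \<in> ?U" using y nQ by (simp add: upper_limit_def)
  ultimately have fr: "\<exists>\<^sub>F t in at_right 0. log_image k (1 / t) (density_profile (even_cycles k)) \<inter> ?U \<noteq> {}"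
    using y unfolding upper_limit_def by blast
  have "\<forall>\<^sub>F t::real in at_right 0. 0 < t \<and> t < 1"
    by (auto simp: eventually_at_right_field intro: exI[of _ 1])
  then have "\<forall>\<^sub>F t in at_right 0. \<not> log_image k (1 / t) (density_profile (even_cycles k)) \<inter> ?U \<noteq> {}"
  proof eventually_elim
    case (elim t)
    then have "1 / t > 1" by simp
    from log_image_subset_Q_cone[OF assms this] show ?case by blast
  qed
  with fr show False by (simp add: frequently_def)
qed

text \<open>Both limits are squeezed: the cone lies in the lower limit, this in the upper limit as
  the filter is nontrivial, and this in the cone.\<close>

lemma is_trop_even_cycles:
  assumes "k \<ge> 2"
  shows "is_trop k (density_profile (even_cycles k)) (Q_cone k)"
proof -
  let ?A = "\<lambda>t. log_image k (1 / t) (density_profile (even_cycles k))"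
  have "lower_limit (Euclidean_space k) ?A (at_right 0) \<subseteq> upper_limit (Euclidean_space k) ?A (at_right 0)"
    unfolding lower_limit_def upper_limit_def by (auto intro!: eventually_frequently)
  then show ?thesis
    unfolding is_trop_def set_limit_def
    using Q_cone_subset_lower_limit[OF assms] upper_limit_subset_Q_cone[OF assms] by blast
qed

theorem theorem4p3:
  fixes k :: nat
  assumes "k \<ge> 2"
  shows "(\<exists>L. is_trop k (density_profile (even_cycles k)) L) \<and>
    trop k (density_profile (even_cycles k)) = Q_cone k"
proof -
  have "trop k (density_profile (even_cycles k)) = Q_cone k"
    unfolding trop_def using is_trop_even_cycles[OF assms]
    by (rule the_equality) (metis is_trop_def is_trop_even_cycles[OF assms] set_limit_unique)
  then show ?thesis using is_trop_even_cycles[OF assms] by blast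
qed

end
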